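(* For every $k\in\mathbb{N}$, none of the following functionals is computable (in Kleene's S1–S9 sense) in $\mathsf{S}_k^{2}$: (a) any functional $\Phi:(\mathbb{R}\to\mathbb{R})\to(\mathbb{R}^2\to\mathbb{R})$ such that for every Baire 2 function $f:[0,1]\to[0,1]$ we have $\Phi(f,p,q)=\sup_{x\in[p,q]}f(x)$ for $p,q\in[0,1]$; (b) any functional $\Psi:(\mathbb{R}\to\mathbb{R})\to(\mathbb{N}^2\to(\mathbb{R}\to\mathbb{R}))$ such that for every Baire 2 function $f:[0,1]\to[0,1]$, each $\Psi(f,n,m)$ is continuous on $[0,1]$ and $f(x)=\lim_{n\to\infty}\lim_{m\to\infty}\Psi(f,n,m)(x)$ for all $x\in[0,1]$. Here, for Baire 2 $f$, the associated sequence of Baire 1 functions converging pointwise to $f$ is also given as input. Moreover, each of these functionals, together with $\mathsf{S}^{2}$, computes a Cantor realiser.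
   Context: Computability is Kleene's higher-order computability given by S1–S9. $\mathsf{S}_k^{2}$ is the type-2 functional deciding the truth of $\Sigma^1_k$-formulas (parameters over $\mathbb{N}$ and $\mathbb{N}^{\mathbb{N}}$ only); $\mathsf{S}^2=\mathsf{S}^2_1$ is the Suslin functional: $\mathsf{S}(f)=0\leftrightarrow(\exists g\in\mathbb{N}^{\mathbb{N}})(\forall n)(f(\overline{g}n)=0)$. A function $f:[0,1]\to\mathbb{R}$ is Baire 1 if it is the pointwise limit of a sequence of continuous functions, and Baire 2 if it is the pointwise limit of a sequence of Baire 1 functions. Subsets $A\subset\mathbb{R}$ are given by characteristic functions. A Cantor realiser is any $\Phi:((\mathbb{R}\to\{0,1\})\times(\mathbb{R}\to\mathbb{N}))\to\mathbb{R}$ such that $\Phi(A,Y)\notin A$ whenever $A\subset[0,1]$ is non-empty and $Y:[0,1]\to\mathbb{N}$ is injective on $A$. *)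

theory Defs
  imports "HOL-Analysis.Analysis" "HOL-Library.Nat_Bijection" "HOL-Library.Countable"
begin

section \<open>Kleene's schemes S1--S9\<close>

type_synonym type1 = "nat \<Rightarrow> nat"
type_synonym type2 = "type1 \<Rightarrow> nat"
type_synonym type3 = "type2 \<Rightarrow> nat"

definition to_front :: "nat \<Rightarrow> 'a list \<Rightarrow> 'a list" where
  "to_front k xs = xs ! k # take k xs @ drop (Suc k) xs"

text \<open>
  \<open>kleene e as fs Fs Gs v\<close> means that \<open>{e}(as, fs, Fs, Gs)\<close> is defined with value \<open>v\<close>. As in Kleene's
  original definition, arguments are of pure type, and only the relative order of arguments of the
  same type matters; the arguments of types 0, 1, 2 and 3 are therefore kept in separate lists.
  Indices are sequence numbers \<open>\<langle>i, \<dots>\<rangle>\<close> with \<open>i\<close> the number of the scheme. In S6 and S8 the second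
  entry is the type of the argument concerned.
\<close>

inductive kleene ::
    "nat \<Rightarrow> nat list \<Rightarrow> type1 list \<Rightarrow> type2 list \<Rightarrow> type3 list \<Rightarrow> nat \<Rightarrow> bool" where
  S1: "kleene (list_encode [1]) (a # as) fs Fs Gs (Suc a)"
| S2: "kleene (list_encode [2, q]) as fs Fs Gs q"
| S3: "kleene (list_encode [3]) (a # as) fs Fs Gs a"
| S4: "kleene d as fs Fs Gs u \<Longrightarrow> kleene c (u # as) fs Fs Gs v \<Longrightarrow>
       kleene (list_encode [4, c, d]) as fs Fs Gs v"
| S5_zero: "kleene c as fs Fs Gs v \<Longrightarrow> kleene (list_encode [5, c, d]) (0 # as) fs Fs Gs v"
| S5_Suc: "kleene (list_encode [5, c, d]) (a # as) fs Fs Gs u \<Longrightarrow>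
       kleene d (a # u # as) fs Fs Gs v \<Longrightarrow>
       kleene (list_encode [5, c, d]) (Suc a # as) fs Fs Gs v"
| S6_0: "k < length as \<Longrightarrow> kleene d (to_front k as) fs Fs Gs v \<Longrightarrow>
       kleene (list_encode [6, 0, k, d]) as fs Fs Gs v"
| S6_1: "k < length fs \<Longrightarrow> kleene d as (to_front k fs) Fs Gs v \<Longrightarrow>
       kleene (list_encode [6, 1, k, d]) as fs Fs Gs v"
| S6_2: "k < length Fs \<Longrightarrow> kleene d as fs (to_front k Fs) Gs v \<Longrightarrow>
       kleene (list_encode [6, 2, k, d]) as fs Fs Gs v"
| S6_3: "k < length Gs \<Longrightarrow> kleene d as fs Fs (to_front k Gs) v \<Longrightarrow>
       kleene (list_encode [6, 3, k, d]) as fs Fs Gs v"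
| S7: "kleene (list_encode [7]) (a # as) (f # fs) Fs Gs (f a)"
| S8_2: "(\<And>n. kleene d (n # as) fs (F # Fs) Gs (h n)) \<Longrightarrow>
       kleene (list_encode [8, 2, d]) as fs (F # Fs) Gs (F h)"
| S8_3: "(\<And>g. kleene d as (g # fs) Fs (G # Gs) (H g)) \<Longrightarrow>
       kleene (list_encode [8, 3, d]) as fs Fs (G # Gs) (G H)"
| S9: "m0 \<le> length as \<Longrightarrow> m1 \<le> length fs \<Longrightarrow> m2 \<le> length Fs \<Longrightarrow> m3 \<le> length Gs \<Longrightarrow>
       kleene d (take m0 as) (take m1 fs) (take m2 Fs) (take m3 Gs) v \<Longrightarrow>
       kleene (list_encode [9, m0, m1, m2, m3]) (d # as) fs Fs Gs v"

lemma kleene_deterministic_aux: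
  "kleene e as fs Fs Gs v \<Longrightarrow> \<forall>w. kleene e as fs Fs Gs w \<longrightarrow> v = w"
proof (induction rule: kleene.induct)
  case (S8_2 d as fs F Fs Gs h)
  show ?case
  proof (intro allI impI)
    fix w
    assume "kleene (list_encode [8, 2, d]) as fs (F # Fs) Gs w"
    then have "\<exists>h'. w = F h' \<and> (\<forall>n. kleene d (n # as) fs (F # Fs) Gs (h' n))"
      by (cases rule: kleene.cases) (auto simp: list_encode_eq simp del: list_encode.simps)
    then obtain h' where h': "w = F h'" "\<forall>n. kleene d (n # as) fs (F # Fs) Gs (h' n)"
      by (elim exE conjE)
    have "h = h'"
      using S8_2.IH h'(2) by (simp add: fun_eq_iff)
    with h'(1) show "F h = w" by simp
  qed
next
  case (S8_3 d as fs Fs G Gs H)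
  show ?case
  proof (intro allI impI)
    fix w
    assume "kleene (list_encode [8, 3, d]) as fs Fs (G # Gs) w"
    then have "\<exists>H'. w = G H' \<and> (\<forall>g. kleene d as (g # fs) Fs (G # Gs) (H' g))"
      by (cases rule: kleene.cases) (auto simp: list_encode_eq simp del: list_encode.simps)
    then obtain H' where H': "w = G H'" "\<forall>g. kleene d as (g # fs) Fs (G # Gs) (H' g)"
      by (elim exE conjE)
    have "H = H'"
      using S8_3.IH H'(2) by (simp add: fun_eq_iff)
    with H'(1) show "G H = w" by simp
  qed
next
  case (S1 a as fs Fs Gs)
  have "Suc a = w" if "kleene (list_encode [1]) (a # as) fs Fs Gs w" for w
    using that by (cases rule: kleene.cases)
      (auto simp: list_encode_eq simp del: list_encode.simps)
  then show ?case by blast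
next
  case (S2 q as fs Fs Gs)
  have "q = w" if "kleene (list_encode [2, q]) as fs Fs Gs w" for w
    using that by (cases rule: kleene.cases)
      (auto simp: list_encode_eq simp del: list_encode.simps)
  then show ?case by blast
next
  case (S3 a as fs Fs Gs)
  have "a = w" if "kleene (list_encode [3]) (a # as) fs Fs Gs w" for w
    using that by (cases rule: kleene.cases)
      (auto simp: list_encode_eq simp del: list_encode.simps)
  then show ?case by blast
next
  case (S4 d as fs Fs Gs u c v)
  have "v = w" if "kleene (list_encode [4, c, d]) as fs Fs Gs w" for w
    using that by (cases rule: kleene.cases)
      (use S4.IH in \<open>auto simp: list_encode_eq simp del: list_encode.simps\<close>)
  then show ?case by blast
next
  case (S5_zero c as fs Fs Gs v d)
  have "v = w" if "kleene (list_encode [5, c, d]) (0 # as) fs Fs Gs w" for w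
    using that by (cases rule: kleene.cases)
      (use S5_zero.IH in \<open>auto simp: list_encode_eq simp del: list_encode.simps\<close>)
  then show ?case by blast
next
  case (S5_Suc c d a as fs Fs Gs u v)
  have "v = w" if "kleene (list_encode [5, c, d]) (Suc a # as) fs Fs Gs w" for w
    using that by (cases rule: kleene.cases)
      (use S5_Suc.IH in \<open>auto simp: list_encode_eq simp del: list_encode.simps\<close>)
  then show ?case by blast
next
  case (S6_0 k as d fs Fs Gs v)
  have "v = w" if "kleene (list_encode [6, 0, k, d]) as fs Fs Gs w" for w
    using that by (cases rule: kleene.cases)
      (use S6_0.IH in \<open>auto simp: list_encode_eq simp del: list_encode.simps\<close>)
  then show ?case by blast
next
  case (S6_1 k fs d as Fs Gs v)
  have "v = w" if "kleene (list_encode [6, 1, k, d]) as fs Fs Gs w" for w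
    using that by (cases rule: kleene.cases)
      (use S6_1.IH in \<open>auto simp: list_encode_eq simp del: list_encode.simps\<close>)
  then show ?case by blast
next
  case (S6_2 k Fs d as fs Gs v)
  have "v = w" if "kleene (list_encode [6, 2, k, d]) as fs Fs Gs w" for w
    using that by (cases rule: kleene.cases)
      (use S6_2.IH in \<open>auto simp: list_encode_eq simp del: list_encode.simps\<close>)
  then show ?case by blast
next
  case (S6_3 k Gs d as fs Fs v)
  have "v = w" if "kleene (list_encode [6, 3, k, d]) as fs Fs Gs w" for w
    using that by (cases rule: kleene.cases)
      (use S6_3.IH in \<open>auto simp: list_encode_eq simp del: list_encode.simps\<close>)
  then show ?case by blast
next
  case (S7 a as f fs Fs Gs)
  have "f a = w" if "kleene (list_encode [7]) (a # as) (f # fs) Fs Gs w" for w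
    using that by (cases rule: kleene.cases)
      (auto simp: list_encode_eq simp del: list_encode.simps)
  then show ?case by blast
next
  case (S9 m0 as m1 fs m2 Fs m3 Gs d v)
  have "v = w" if "kleene (list_encode [9, m0, m1, m2, m3]) (d # as) fs Fs Gs w" for w
    using that by (cases rule: kleene.cases)
      (use S9.IH in \<open>auto simp: list_encode_eq simp del: list_encode.simps\<close>)
  then show ?case by blast
qed

lemma kleene_deterministic:
  assumes "kleene e as fs Fs Gs v" "kleene e as fs Fs Gs w"
  shows "v = w"
  using assms kleene_deterministic_aux by blast


section \<open>The Suslin functional and its generalisations\<close>

definition course :: "type1 \<Rightarrow> nat \<Rightarrow> nat" where
  "course g n = list_encode (map g [0..<n])"

definition suslin :: type2 where
  "suslin f = (if \<exists>g. \<forall>n. f (course g n) = 0 then 0 else 1)"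

fun courses :: "type1 list \<Rightarrow> nat \<Rightarrow> nat" where
  "courses [] n = n"
| "courses [g] n = course g n"
| "courses (g # h # gs) n = prod_encode (course g n, courses (h # gs) n)"

text \<open>
  \<open>alternating k True [] f\<close> is the \<open>\<Sigma>\<^sup>1\<^sub>k\<close>-formula in Kleene normal form
  \<open>\<exists>g\<^sub>1 \<forall>g\<^sub>2 \<dots> Q g\<^sub>k Q' n. f (\<langle>course g\<^sub>1 n, \<dots>, course g\<^sub>k n\<rangle>) = 0\<close>, in which all quantifiers alternate,
  including the final number quantifier \<open>Q'\<close>. For \<open>k = 0\<close> it is \<open>\<exists>n. f n = 0\<close>.
\<close>

primrec alternating :: "nat \<Rightarrow> bool \<Rightarrow> type1 list \<Rightarrow> type1 \<Rightarrow> bool" where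
  "alternating 0 ex gs f =
     (if ex then \<exists>n. f (courses gs n) = 0 else \<forall>n. f (courses gs n) = 0)"
| "alternating (Suc k) ex gs f =
     (if ex then \<exists>g. alternating k False (gs @ [g]) f
      else \<forall>g. alternating k True (gs @ [g]) f)"

definition S_functional :: "nat \<Rightarrow> type2" where
  "S_functional k f = (if alternating k True [] f then 0 else 1)"

lemma S_functional_1: "S_functional 1 = suslin"
  by (simp add: fun_eq_iff S_functional_def suslin_def)


section \<open>Representations of reals and of functions on the reals\<close>

definition rat_seq :: "type1 \<Rightarrow> nat \<Rightarrow> real" where
  "rat_seq P n = of_rat (nat_to_rat_surj (P n))"

definition codes :: "type1 \<Rightarrow> real \<Rightarrow> bool" where
  "codes P x \<longleftrightarrow>
     (\<forall>n i. \<bar>rat_seq P n - rat_seq P (n + i)\<bar> < 1 / 2 ^ n) \<and> rat_seq P \<longlonglongrightarrow> x"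

definition codes_fun :: "(type1 \<Rightarrow> type1) \<Rightarrow> (real \<Rightarrow> real) \<Rightarrow> bool" where
  "codes_fun F f \<longleftrightarrow> (\<forall>X x. codes X x \<longrightarrow> codes (F X) (f x))"

definition codes_nat_fun :: "type2 \<Rightarrow> (real \<Rightarrow> nat) \<Rightarrow> bool" where
  "codes_nat_fun y Y \<longleftrightarrow> (\<forall>X x. codes X x \<longrightarrow> y X = Y x)"

definition codes_set :: "type2 \<Rightarrow> real set \<Rightarrow> bool" where
  "codes_set a A \<longleftrightarrow> codes_nat_fun a (indicator A)"

text \<open>
  Kleene computations only take arguments of pure type, so objects of other types are passed
  through the usual codings. A type 1 object \<open>n ## z\<close> codes the pair of \<open>n\<close> and \<open>z\<close>.
\<close>

abbreviation ncons :: "nat \<Rightarrow> type1 \<Rightarrow> type1"  (infixr "##" 65) where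
  "n ## z \<equiv> case_nat n z"

abbreviation zeros :: type1 where
  "zeros \<equiv> (\<lambda>_. 0)"

definition flat_fun :: "(type1 \<Rightarrow> type1) \<Rightarrow> type2" where
  "flat_fun F = (\<lambda>z. F (\<lambda>i. z (i + 1)) (z 0))"

definition flat_seq :: "(nat \<Rightarrow> type1 \<Rightarrow> type1) \<Rightarrow> type2" where
  "flat_seq Fs = (\<lambda>z. Fs (z 0) (\<lambda>i. z (i + 2)) (z 1))"

lemma flat_fun_ncons [simp]: "flat_fun F (m ## X) = F X m"
  by (simp add: flat_fun_def)

lemma flat_seq_ncons [simp]: "flat_seq Fs (n ## m ## X) = Fs n X m"
  by (simp add: flat_seq_def)


section \<open>Baire classes on the unit interval\<close>

definition baire1 :: "(real \<Rightarrow> real) \<Rightarrow> bool" where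
  "baire1 f \<longleftrightarrow> (\<exists>g. (\<forall>n. continuous_on {0..1} (g n)) \<and>
                    (\<forall>x\<in>{0..1}. (\<lambda>n::nat. g n x) \<longlonglongrightarrow> f x))"

definition baire2 :: "(real \<Rightarrow> real) \<Rightarrow> bool" where
  "baire2 f \<longleftrightarrow> (\<exists>g. (\<forall>n. baire1 (g n)) \<and> (\<forall>x\<in>{0..1}. (\<lambda>n::nat. g n x) \<longlonglongrightarrow> f x))"

text \<open>
  Admissible inputs: a Baire 2 function \<open>[0,1] \<rightarrow> [0,1]\<close>, given as (the restriction of) a function on
  the reals, with a sequence of Baire 1 functions converging to it on \<open>[0,1]\<close>.
\<close>

definition baire2_data :: "(real \<Rightarrow> real) \<Rightarrow> (nat \<Rightarrow> real \<Rightarrow> real) \<Rightarrow> bool" where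
  "baire2_data f fs \<longleftrightarrow> baire2 f \<and> f ` {0..1} \<subseteq> {0..1} \<and>
     (\<forall>n. baire1 (fs n)) \<and> (\<forall>x\<in>{0..1}. (\<lambda>n. fs n x) \<longlonglongrightarrow> f x)"

definition codes_data ::
    "(type1 \<Rightarrow> type1) \<Rightarrow> (nat \<Rightarrow> type1 \<Rightarrow> type1) \<Rightarrow> (real \<Rightarrow> real) \<Rightarrow> (nat \<Rightarrow> real \<Rightarrow> real) \<Rightarrow> bool" where
  "codes_data F Fs f fs \<longleftrightarrow> codes_fun F f \<and> (\<forall>n. codes_fun (Fs n) (fs n))"


section \<open>The supremum functionals\<close>

text \<open>
  A functional on \<open>\<real> \<rightarrow> \<real>\<close> acts on representations; it is not required to map different
  representations of the same function to equal results where its specification leaves it a choice.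
\<close>

type_synonym sup_functional =
  "(type1 \<Rightarrow> type1) \<Rightarrow> (nat \<Rightarrow> type1 \<Rightarrow> type1) \<Rightarrow> type1 \<Rightarrow> type1 \<Rightarrow> type1"

definition is_sup_functional :: "sup_functional \<Rightarrow> bool" where
  "is_sup_functional \<Phi> \<longleftrightarrow>
     (\<forall>f fs F Fs p q P Q.
        baire2_data f fs \<and> codes_data F Fs f fs \<and>
        0 \<le> p \<and> p \<le> q \<and> q \<le> 1 \<and> codes P p \<and> codes Q q \<longrightarrow>
        codes (\<Phi> F Fs P Q) (SUP x\<in>{p..q}. f x))"

definition sup_computable_in :: "sup_functional \<Rightarrow> type2 \<Rightarrow> bool" where
  "sup_computable_in \<Phi> S \<longleftrightarrow>
     (\<exists>e. \<forall>f fs F Fs p q P Q. codes_data F Fs f fs \<and> codes P p \<and> codes Q q \<longrightarrow>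
        (\<forall>l. kleene e [l] [P, Q] [S, flat_fun F, flat_seq Fs] [] (\<Phi> F Fs P Q l)))"

definition sup_type3 :: "sup_functional \<Rightarrow> type3" where
  "sup_type3 \<Phi> = (\<lambda>Z. \<Phi> (\<lambda>X l. Z (0 ## l ## X)) (\<lambda>n X l. Z (1 ## n ## l ## X))
     (\<lambda>l. Z (2 ## l ## zeros)) (\<lambda>l. Z (3 ## l ## zeros)) (Z (4 ## zeros)))"

lemma sup_type3_surj: "\<exists>Z. \<forall>\<Phi>. sup_type3 \<Phi> Z = \<Phi> F Fs P Q l"
proof -
  let ?Z = "\<lambda>z. let w = (\<lambda>i. z (i + 1)) in
    if z 0 = 0 then flat_fun F w else if z 0 = 1 then flat_seq Fs w
    else if z 0 = 2 then P (w 0) else if z 0 = 3 then Q (w 0) else l"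
  have "sup_type3 \<Phi> ?Z = \<Phi> F Fs P Q l" for \<Phi>
    by (simp add: sup_type3_def)
  then show ?thesis by blast
qed


section \<open>The approximation functionals\<close>

type_synonym approx_functional =
  "(type1 \<Rightarrow> type1) \<Rightarrow> (nat \<Rightarrow> type1 \<Rightarrow> type1) \<Rightarrow> nat \<Rightarrow> nat \<Rightarrow> type1 \<Rightarrow> type1"

definition is_approx_functional :: "approx_functional \<Rightarrow> bool" where
  "is_approx_functional \<Psi> \<longleftrightarrow>
     (\<forall>f fs F Fs. baire2_data f fs \<and> codes_data F Fs f fs \<longrightarrow>
        (\<exists>g. (\<forall>n m. continuous_on {0..1} (g n m) \<and>
                    (\<forall>x\<in>{0..1}. \<forall>X. codes X x \<longrightarrow> codes (\<Psi> F Fs n m X) (g n m x))) \<and>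
             (\<forall>x\<in>{0..1}. \<exists>c. (\<forall>n. (\<lambda>m. g n m x) \<longlonglongrightarrow> c n) \<and> c \<longlonglongrightarrow> f x)))"

definition approx_computable_in :: "approx_functional \<Rightarrow> type2 \<Rightarrow> bool" where
  "approx_computable_in \<Psi> S \<longleftrightarrow>
     (\<exists>e. \<forall>f fs F Fs x X. codes_data F Fs f fs \<and> codes X x \<longrightarrow>
        (\<forall>n m l. kleene e [n, m, l] [X] [S, flat_fun F, flat_seq Fs] [] (\<Psi> F Fs n m X l)))"

definition approx_type3 :: "approx_functional \<Rightarrow> type3" where
  "approx_type3 \<Psi> = (\<lambda>Z. \<Psi> (\<lambda>X l. Z (0 ## l ## X)) (\<lambda>n X l. Z (1 ## n ## l ## X))
     (Z (2 ## zeros)) (Z (3 ## zeros)) (\<lambda>l. Z (4 ## l ## zeros)) (Z (5 ## zeros)))"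

lemma approx_type3_surj: "\<exists>Z. \<forall>\<Psi>. approx_type3 \<Psi> Z = \<Psi> F Fs n m X l"
proof -
  let ?Z = "\<lambda>z. let w = (\<lambda>i. z (i + 1)) in
    if z 0 = 0 then flat_fun F w else if z 0 = 1 then flat_seq Fs w
    else if z 0 = 2 then n else if z 0 = 3 then m else if z 0 = 4 then X (w 0) else l"
  have "approx_type3 \<Psi> ?Z = \<Psi> F Fs n m X l" for \<Psi>
    by (simp add: approx_type3_def)
  then show ?thesis by blast
qed


section \<open>Cantor realisers\<close>

text \<open>
  The value is required to lie in \<open>[0,1]\<close>: otherwise a constant such as \<open>2\<close> would do.
\<close>

definition cantor_realiser :: "(real set \<Rightarrow> (real \<Rightarrow> nat) \<Rightarrow> real) \<Rightarrow> bool" where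
  "cantor_realiser C \<longleftrightarrow>
     (\<forall>A Y. A \<subseteq> {0..1} \<and> A \<noteq> {} \<and> inj_on Y A \<longrightarrow> C A Y \<in> {0..1} - A)"

definition cantor_computable_in ::
    "(real set \<Rightarrow> (real \<Rightarrow> nat) \<Rightarrow> real) \<Rightarrow> type3 \<Rightarrow> type2 \<Rightarrow> bool" where
  "cantor_computable_in C G S \<longleftrightarrow>
     (\<exists>e. \<forall>A Y a y. codes_set a A \<and> codes_nat_fun y Y \<longrightarrow>
        (\<exists>X. codes X (C A Y) \<and> (\<forall>l. kleene e [l] [] [S, a, y] [G] (X l))))"

end

theory Submission
  imports Defs
begin

text \<open>
  Both kinds of functional are applied only to indicator functions of sets \<open>B\<close> with at most one element.
  From its values one can decide whether the point of \<open>B\<close> lies in a rational interval, up to the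
  end points: for \<open>\<Phi>\<close> this is a supremum, for \<open>\<Psi>\<close> it is a \<open>\<Sigma>\<^sup>1\<^sub>1\<close> question about the values of the
  continuous functions at rational points. Given sets \<open>B\<^sub>n = {x \<in> A. Y x = n}\<close>, such decisions yield, by
  nested intervals, a real outside \<open>A\<close>. All of this can be carried out by schemes S1--S9 in \<open>suslin\<close>,
  which gives the Cantor realisers.

  For the negative part, let \<open>Y\<close> be a maximal partial map from reals to indices such that \<open>Y x\<close> is an
  index of an algorithm that computes \<open>x\<close> relative to \<open>S\<close> and every extension of \<open>Y\<close>. Then \<open>Y\<close> is
  injective, and a computation relative to \<open>S\<close> and \<open>Y\<close> only ever queries \<open>Y\<close> on its domain, by maximality.
  If \<open>\<Phi>\<close> or \<open>\<Psi>\<close> were computable in \<open>S\<close>, its values on the indicator functions of the level sets of \<open>Y\<close>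
  would not change when \<open>Y\<close> is extended, so the real that escapes the domain of \<open>Y\<close> would belong to it.
\<close>

section \<open>Codes of rationals and reals\<close>

definition rat_of :: "nat \<Rightarrow> real" where
  "rat_of c = of_rat (nat_to_rat_surj c)"

text \<open>Schemes S1--S9 act on natural numbers, so a coded integer is handled as a difference of
  two naturals. Comparisons of rationals then become inequalities between naturals.\<close>

definition int_pos :: "nat \<Rightarrow> nat" where
  "int_pos a = (if even a then a div 2 else 0)"

definition int_neg :: "nat \<Rightarrow> nat" where
  "int_neg a = (if even a then 0 else Suc (a div 2))"

text \<open>A negative denominator is made positive by exchanging the two parts of the numerator. A
  zero denominator codes the rational 0, hence the fraction 0/1.\<close>

definition rat_pos :: "nat \<Rightarrow> nat" where
  "rat_pos c = (if snd (prod_decode c) = 0 then 0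
     else if even (snd (prod_decode c)) then int_pos (fst (prod_decode c))
     else int_neg (fst (prod_decode c)))"

definition rat_neg :: "nat \<Rightarrow> nat" where
  "rat_neg c = (if snd (prod_decode c) = 0 then 0
     else if even (snd (prod_decode c)) then int_neg (fst (prod_decode c))
     else int_pos (fst (prod_decode c)))"

definition rat_den :: "nat \<Rightarrow> nat" where
  "rat_den c = (if snd (prod_decode c) = 0 then 1
     else int_pos (snd (prod_decode c)) + int_neg (snd (prod_decode c)))"

lemma int_decode_pos_neg: "int_decode a = int (int_pos a) - int (int_neg a)"
  by (simp add: int_decode_def sum_decode_def int_pos_def int_neg_def)

lemma rat_den_pos [simp]: "rat_den c > 0"
  by (auto simp: rat_den_def int_pos_def int_neg_def elim!: evenE)

lemma rat_of_eq: "rat_of c = (real (rat_pos c) - real (rat_neg c)) / real (rat_den c)"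
proof -
  obtain a b where ab: "prod_decode c = (a, b)" by fastforce
  have "rat_of c = real_of_int (int_decode a) / real_of_int (int_decode b)"
    by (simp add: rat_of_def nat_to_rat_surj_def ab of_rat_rat Fract_of_int_quotient of_rat_divide)
  moreover have "real_of_int (int_decode a) = real (int_pos a) - real (int_neg a)" for a
    by (simp add: int_decode_pos_neg)
  moreover have "real_of_int (int_decode b) = (if even b then 1 else - 1) * real (int_pos b + int_neg b)"
    by (simp add: int_decode_pos_neg int_pos_def int_neg_def)
  moreover have "x / (- 1 * y) = - x / y" for x y :: real by simp
  ultimately show ?thesis
    by (simp add: rat_pos_def rat_neg_def rat_den_def ab int_pos_def int_neg_def
        del: of_nat_add of_nat_Suc)
qed

definition rat_code :: "nat \<Rightarrow> nat \<Rightarrow> nat" where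
  "rat_code m d = prod_encode (m + m, d + d)"

lemma int_decode_double [simp]: "int_decode (m + m) = int m"
  by (simp add: int_decode_def sum_decode_def flip: mult_2)

lemma rat_of_rat_code [simp]: "rat_of (rat_code m d) = real m / real d"
  by (simp add: rat_of_def rat_code_def nat_to_rat_surj_def Fract_of_int_quotient of_rat_divide)

lemma rat_seq_rat_of: "rat_seq P n = rat_of (P n)"
  by (simp add: rat_seq_def rat_of_def)

text \<open>Denominators are cleared and negative parts moved to the other side. At least one of the
  two truncated differences is 0, so together they bound an absolute value.\<close>

definition rat_near :: "nat \<Rightarrow> nat \<Rightarrow> nat \<Rightarrow> bool" where
  "rat_near c c' n \<longleftrightarrow>
     (let x = rat_pos c * rat_den c' + rat_neg c' * rat_den c;
          y = rat_pos c' * rat_den c + rat_neg c * rat_den c'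
      in (x - y) * 2 ^ n < rat_den c * rat_den c' \<and> (y - x) * 2 ^ n < rat_den c * rat_den c')"

definition rat_between :: "nat \<Rightarrow> nat \<Rightarrow> nat \<Rightarrow> nat \<Rightarrow> bool" where
  "rat_between c m m' d \<longleftrightarrow>
     m * rat_den c + d * rat_neg c \<le> d * rat_pos c \<and> d * rat_pos c \<le> m' * rat_den c + d * rat_neg c"

definition rat_above_half :: "nat \<Rightarrow> bool" where
  "rat_above_half c \<longleftrightarrow> rat_den c + (rat_neg c + rat_neg c) < rat_pos c + rat_pos c"

lemma rat_near_iff: "rat_near c c' n \<longleftrightarrow> \<bar>rat_of c - rat_of c'\<bar> < 1 / 2 ^ n"
proof -
  define x where "x = rat_pos c * rat_den c' + rat_neg c' * rat_den c"
  define y where "y = rat_pos c' * rat_den c + rat_neg c * rat_den c'"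
  define D where "D = rat_den c * rat_den c'"
  have D: "D > 0" by (simp add: D_def)
  have "rat_of c - rat_of c' = (real x - real y) / real D"
    by (simp add: rat_of_eq x_def y_def D_def field_simps)
  then have "\<bar>rat_of c - rat_of c'\<bar> < 1 / 2 ^ n \<longleftrightarrow> \<bar>(real x - real y) / real D\<bar> < 1 / 2 ^ n"
    by simp
  also have "\<dots> \<longleftrightarrow> \<bar>real x - real y\<bar> * 2 ^ n < real D"
    using D by (simp add: abs_divide field_simps)
  finally have "\<bar>rat_of c - rat_of c'\<bar> < 1 / 2 ^ n \<longleftrightarrow> \<bar>real x - real y\<bar> * 2 ^ n < real D" .
  moreover have "rat_near c c' n \<longleftrightarrow> (x - y) * 2 ^ n < D \<and> (y - x) * 2 ^ n < D"
    by (simp add: rat_near_def x_def y_def D_def Let_def)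
  moreover have "(u - v) * 2 ^ n < D \<longleftrightarrow> (real u - real v) * 2 ^ n < real D" for u v :: nat
  proof (cases "v \<le> u")
    case True
    then have "(real u - real v) * 2 ^ n = real ((u - v) * 2 ^ n)"
      by (simp add: of_nat_diff)
    then show ?thesis by (metis of_nat_less_iff)
  next
    case False
    then have "(real u - real v) * 2 ^ n \<le> 0"
      by (simp add: mult_nonpos_nonneg)
    then show ?thesis using False D by auto
  qed
  moreover have "\<bar>real x - real y\<bar> * 2 ^ n < real D \<longleftrightarrow>
      (real x - real y) * 2 ^ n < real D \<and> (real y - real x) * 2 ^ n < real D"
  proof -
    have "\<bar>a\<bar> * p < e \<longleftrightarrow> a * p < e \<and> - a * p < e" if "e > 0" "p > 0" for a p e :: real
      using that by (cases "a \<ge> 0") (auto intro: le_less_trans[of _ 0] simp: mult_le_0_iff)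
    from this[of "real D" "2 ^ n" "real x - real y"] D show ?thesis by simp
  qed
  ultimately show ?thesis by simp
qed

lemma rat_between_iff:
  assumes "d > 0"
  shows "rat_between c m m' d \<longleftrightarrow> rat_of c \<in> {real m / real d .. real m' / real d}"
proof -
  have le: "a \<le> b \<longleftrightarrow> real a \<le> real b" for a b :: nat by simp
  show ?thesis
    unfolding rat_between_def rat_of_eq le of_nat_add of_nat_mult
    using assms rat_den_pos[of c] by (auto simp: field_simps simp del: rat_den_pos)
qed

lemma rat_above_half_iff: "rat_above_half c \<longleftrightarrow> rat_of c > 1 / 2"
proof -
  have less: "a < b \<longleftrightarrow> real a < real b" for a b :: nat by simp
  show ?thesis
    unfolding rat_above_half_def rat_of_eq less of_nat_add
    using rat_den_pos[of c] by (auto simp: field_simps simp del: rat_den_pos)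
qed

lemma rat_of_dense:
  assumes "a < b"
  obtains c where "a < rat_of c" "rat_of c < b"
proof -
  obtain r where "a < of_rat r" "of_rat r < b" using of_rat_dense[OF assms] by blast
  moreover obtain c where "r = nat_to_rat_surj c" using surj_nat_to_rat_surj by blast
  ultimately show thesis using that by (simp add: rat_of_def)
qed

definition is_code :: "type1 \<Rightarrow> bool" where
  "is_code X \<longleftrightarrow> (\<forall>n i. rat_near (X n) (X (n + i)) n)"

lemma codes_unique: "codes X x \<Longrightarrow> codes X y \<Longrightarrow> x = y"
  by (auto simp: codes_def intro: LIMSEQ_unique)

text \<open>The limit exists by completeness and need not be mentioned in \<open>is_code\<close>.
  The set of codes thereby becomes arithmetical, so that programs can test it.\<close>

lemma is_code_iff: "is_code X \<longleftrightarrow> (\<exists>x. codes X x)"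
proof
  assume X: "is_code X"
  have "Cauchy (rat_seq X)"
  proof (rule metric_CauchyI)
    fix e :: real assume "e > 0"
    then obtain M where M: "1 / 2 ^ M < e / 2"
      using reals_power_lt_ex[of "e / 2" 2] by (auto simp: power_one_over divide_simps)
    have "dist (rat_seq X m) (rat_seq X M) < e / 2" if "m \<ge> M" for m
    proof -
      have "\<bar>rat_of (X M) - rat_of (X (M + (m - M)))\<bar> < 1 / 2 ^ M"
        using X by (simp only: is_code_def rat_near_iff)
      then show ?thesis using M that by (simp add: dist_real_def rat_seq_rat_of abs_minus_commute)
    qed
    then show "\<exists>M. \<forall>m\<ge>M. \<forall>n\<ge>M. dist (rat_seq X m) (rat_seq X n) < e"
      by (meson dist_triangle_half_l)
  qed
  then obtain x where "rat_seq X \<longlonglongrightarrow> x" by (auto simp: Cauchy_convergent_iff convergent_def)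
  then show "\<exists>x. codes X x"
    using X by (auto simp: codes_def is_code_def rat_near_iff rat_seq_rat_of)
qed (auto simp: codes_def is_code_def rat_near_iff rat_seq_rat_of)

lemma codes_const: "codes (\<lambda>_. c) (rat_of c)"
proof -
  have "rat_seq (\<lambda>_. c) = (\<lambda>_. rat_of c)" by (simp add: fun_eq_iff rat_seq_rat_of)
  then show ?thesis by (simp add: codes_def)
qed

lemma codes_dist_le:
  assumes "codes X x"
  shows "\<bar>rat_of (X n) - x\<bar> \<le> 1 / 2 ^ n"
proof (rule tendsto_upperbound)
  have "rat_seq X \<longlonglongrightarrow> x" using assms by (simp add: codes_def)
  then have "(\<lambda>i. rat_seq X (i + n)) \<longlonglongrightarrow> x" by (rule LIMSEQ_ignore_initial_segment)
  then show "(\<lambda>i. \<bar>rat_of (X n) - rat_seq X (i + n)\<bar>) \<longlonglongrightarrow> \<bar>rat_of (X n) - x\<bar>"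
    by (intro tendsto_intros)
  show "\<forall>\<^sub>F i in sequentially. \<bar>rat_of (X n) - rat_seq X (i + n)\<bar> \<le> 1 / 2 ^ n"
    using assms
    by (intro always_eventually allI less_imp_le) (simp add: codes_def rat_seq_rat_of add.commute[of _ n])
qed simp

text \<open>Total on type 1 objects, with value 0 off the codes. Representations of two sets can
  thus differ only at codes of reals that lie in exactly one of them.\<close>

definition ind_rep :: "real set \<Rightarrow> type1 \<Rightarrow> type1" where
  "ind_rep B X = (\<lambda>_. if \<exists>x\<in>B. codes X x then rat_code 1 1 else rat_code 0 1)"

lemma codes_data_ind: "codes_data (ind_rep B) (\<lambda>_. ind_rep B) (indicator B) (\<lambda>_. indicator B)"
proof -
  have "codes (ind_rep B X) (indicator B x)" if "codes X x" for X x
  proof -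
    have "(\<exists>x\<in>B. codes X x) \<longleftrightarrow> x \<in> B" using that codes_unique by blast
    then have "ind_rep B X = (\<lambda>_. if x \<in> B then rat_code 1 1 else rat_code 0 1)"
      unfolding ind_rep_def by simp
    then show ?thesis
      using codes_const[of "rat_code 1 1"] codes_const[of "rat_code 0 1"] by simp
  qed
  then show ?thesis by (simp add: codes_data_def codes_fun_def)
qed

lemma baire1_indicator_subsingleton:
  assumes "\<And>x y. x \<in> B \<Longrightarrow> y \<in> B \<Longrightarrow> x = y"
  shows "baire1 (indicator B)"
proof (cases "B = {}")
  case True
  then show ?thesis unfolding baire1_def by (intro exI[of _ "\<lambda>_ _. 0"]) auto
next
  case False
  then obtain b where B: "B = {b}" using assms by blast
  \<comment> \<open>Tents of height 1 and slope \<open>n\<close>: away from \<open>b\<close> they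
    vanish once \<open>n\<close> exceeds the reciprocal of the distance.\<close>
  define g where "g n x = max 0 (1 - real n * \<bar>x - b\<bar>)" for n x
  have "(\<lambda>n. g n x) \<longlonglongrightarrow> indicator B x" for x
  proof (cases "x = b")
    case True
    then show ?thesis by (simp add: g_def B)
  next
    case False
    obtain N where N: "1 / \<bar>x - b\<bar> < real N" using reals_Archimedean2 by blast
    have "g n x = 0" if "n \<ge> N" for n
    proof -
      have "1 / \<bar>x - b\<bar> \<le> real n" using N that by linarith
      then show ?thesis using False by (simp add: g_def divide_simps)
    qed
    then have "\<forall>\<^sub>F n in sequentially. g n x = 0" by (auto simp: eventually_sequentially)
    then show ?thesis using False by (simp add: B tendsto_eventually)
  qed
  moreover have "continuous_on {0..1} (g n)" for n
    unfolding g_def by (intro continuous_intros)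
  ultimately show ?thesis unfolding baire1_def by blast
qed

text \<open>The constant sequence serves both as a witness for \<open>baire2\<close> and as the
  accompanying sequence of Baire 1 functions.\<close>

lemma baire2_data_indicator:
  assumes "\<And>x y. x \<in> B \<Longrightarrow> y \<in> B \<Longrightarrow> x = y"
  shows "baire2_data (indicator B) (\<lambda>_. indicator B)"
  using baire1_indicator_subsingleton[OF assms]
  by (auto simp: baire2_data_def baire2_def indicator_def intro!: exI[of _ "\<lambda>_. indicator B"])

section \<open>Escaping a sequence of sets\<close>

text \<open>The boundary of the interval is left undecided because an approximation functional
  yields closed conditions.\<close>

definition valid_test :: "(nat \<Rightarrow> nat \<Rightarrow> nat \<Rightarrow> bool) \<Rightarrow> real set \<Rightarrow> bool" where
  "valid_test t B \<longleftrightarrow> (\<forall>m m' d. m < m' \<and> m' \<le> d \<longrightarrow>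
     (B \<inter> {real m / real d<..<real m' / real d} \<noteq> {} \<longrightarrow> t m m' d) \<and>
     (t m m' d \<longrightarrow> B \<inter> {real m / real d..real m' / real d} \<noteq> {}))"

text \<open>
  The \<open>n\<close>-th interval is \<open>[m / 5 ^ n, (m + 1) / 5 ^ n]\<close> for \<open>m = escape t n\<close>. If the test claims that the
  \<open>n\<close>-th set meets the first three fifths, the last fifth is disjoint from it, otherwise the second fifth.
\<close>

fun escape :: "(nat \<Rightarrow> nat \<Rightarrow> nat \<Rightarrow> nat \<Rightarrow> bool) \<Rightarrow> nat \<Rightarrow> nat" where
  "escape t 0 = 0"
| "escape t (Suc n) = (if t n (5 * escape t n) (5 * escape t n + 3) (5 ^ Suc n)
     then 5 * escape t n + 4 else 5 * escape t n + 1)"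

definition escape_code :: "(nat \<Rightarrow> nat \<Rightarrow> nat \<Rightarrow> nat \<Rightarrow> bool) \<Rightarrow> type1" where
  "escape_code t n = rat_code (escape t n) (5 ^ n)"

definition escape_real :: "(nat \<Rightarrow> nat \<Rightarrow> nat \<Rightarrow> nat \<Rightarrow> bool) \<Rightarrow> real" where
  "escape_real t = (THE x. codes (escape_code t) x)"

text \<open>Each step appends a base 5 digit, 1 or 4, so the intervals are nested.\<close>

lemma escape_bounds:
  "escape t n * 5 ^ i \<le> escape t (n + i)" "escape t (n + i) < (escape t n + 1) * 5 ^ i"
  by (induction i) (auto split: if_splits)

lemma escape_less: "escape t n < 5 ^ n"
  using escape_bounds(2)[of t 0 n] by simp

lemma escape_step:
  defines "r \<equiv> \<lambda>t n. real (escape t n) / 5 ^ n"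
  shows "r t n \<le> r t (n + i)" "r t (n + i) < r t n + 1 / 5 ^ n"
proof -
  have "real (escape t n * 5 ^ i) \<le> real (escape t (n + i))"
    using escape_bounds(1) by (simp only: of_nat_le_iff)
  then show "r t n \<le> r t (n + i)" by (simp add: r_def field_simps power_add)
  have "real (escape t (n + i)) < real ((escape t n + 1) * 5 ^ i)"
    using escape_bounds(2) by (simp only: of_nat_less_iff)
  then show "r t (n + i) < r t n + 1 / 5 ^ n" by (simp add: r_def field_simps power_add)
qed

lemma codes_escape: "codes (escape_code t) (escape_real t)"
proof -
  have "rat_near (escape_code t n) (escape_code t (n + i)) n" for n i
  proof -
    \<comment> \<open>Lengths \<open>1 / 5 ^ n\<close> stay below the rate \<open>1 / 2 ^ n\<close>
      required of codes.\<close>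
    have "(1::real) / 5 ^ n \<le> 1 / 2 ^ n" by (simp add: frac_le power_mono)
    then have "\<bar>real (escape t n) / 5 ^ n - real (escape t (n + i)) / 5 ^ (n + i)\<bar> < 1 / 2 ^ n"
      using escape_step[of t n i] by linarith
    then show ?thesis by (simp add: rat_near_iff escape_code_def)
  qed
  then obtain x where "codes (escape_code t) x" using is_code_iff is_code_def by blast
  then show ?thesis unfolding escape_real_def by (metis codes_unique theI)
qed

lemma escape_real_bounds:
  "escape_real t \<in> {real (escape t n) / 5 ^ n .. (real (escape t n) + 1) / 5 ^ n}"
proof -
  have "(\<lambda>i. rat_seq (escape_code t) (i + n)) \<longlonglongrightarrow> escape_real t"
    using codes_escape by (intro LIMSEQ_ignore_initial_segment) (simp add: codes_def)
  moreover have "rat_seq (escape_code t) (i + n) \<in> {real (escape t n) / 5 ^ n .. (real (escape t n) + 1) / 5 ^ n}" for i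
  proof -
    have "rat_seq (escape_code t) (i + n) = real (escape t (n + i)) / 5 ^ (n + i)"
      by (simp add: rat_seq_rat_of escape_code_def add.commute)
    then show ?thesis
      using escape_step[of t n i] by (simp add: add_divide_distrib)
  qed
  ultimately show ?thesis
    by (rule closed_sequentially[OF closed_atLeastAtMost, rotated])
qed

lemma escape_real_unit: "escape_real t \<in> {0..1}"
  using escape_real_bounds[of t 0] by simp

text \<open>Either the chosen fifth is a whole fifth away from the closed tested interval, or it
  lies inside the open one; the undecided end points do no harm.\<close>

lemma escape_real_notin:
  assumes t: "valid_test (t n) B" and B: "\<And>x y. x \<in> B \<Longrightarrow> y \<in> B \<Longrightarrow> x = y"
  shows "escape_real t \<notin> B"
proof
  assume x: "escape_real t \<in> B"
  define m where "m = 5 * escape t n"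
  define d :: nat where "d = 5 ^ Suc n"
  \<comment> \<open>\<open>escape_less\<close> keeps the tested interval within the unit interval,
    the range covered by \<open>valid_test\<close>.\<close>
  have md: "m < m + 3" "m + 3 \<le> d" using escape_less[of t n] by (simp_all add: m_def d_def)
  have d: "real d > 0" by (simp add: d_def)
  have E: "escape t (Suc n) = (if t n m (m + 3) d then m + 4 else m + 1)"
    by (simp add: m_def d_def)
  have "real (escape t (Suc n)) \<le> escape_real t * d" "escape_real t * d \<le> real (escape t (Suc n)) + 1"
    using escape_real_bounds[of t "Suc n"] d unfolding d_def
    by (simp_all add: pos_divide_le_eq pos_le_divide_eq del: escape.simps power_Suc)
  note b = this[unfolded E]
  show False
  proof (cases "t n m (m + 3) d")
    case True
    then have "B \<inter> {real m / real d..real (m + 3) / real d} \<noteq> {}"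
      using t md unfolding valid_test_def by blast
    then obtain y where y: "y \<in> B" "y \<le> real (m + 3) / real d" by auto
    have "escape_real t * d \<le> real (m + 3)"
      using B[OF x y(1)] y(2) d by (simp only: pos_le_divide_eq)
    then show False using b(1) True by simp
  next
    case False
    then have "real m < escape_real t * d" "escape_real t * d < real (m + 3)"
      using b by simp_all
    then have "escape_real t \<in> {real m / real d<..<real (m + 3) / real d}"
      using d by (simp only: greaterThanLessThan_iff pos_divide_less_eq pos_less_divide_eq)
    then show False using t md False x unfolding valid_test_def by blast
  qed
qed

section \<open>Locating a point\<close>

text \<open>Entry 2 of a code has error at most \<open>1 / 4\<close>, enough to tell a supremum 0
  from 1 by comparison with \<open>1 / 2\<close>.\<close>

definition sup_test :: "sup_functional \<Rightarrow> real set \<Rightarrow> nat \<Rightarrow> nat \<Rightarrow> nat \<Rightarrow> bool" where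
  "sup_test \<Phi> B m m' d \<longleftrightarrow> rat_above_half
     (\<Phi> (ind_rep B) (\<lambda>_. ind_rep B) (\<lambda>_. rat_code m d) (\<lambda>_. rat_code m' d) 2)"

lemma valid_sup_test:
  assumes \<Phi>: "is_sup_functional \<Phi>" and B: "\<And>x y. x \<in> B \<Longrightarrow> y \<in> B \<Longrightarrow> x = y"
  shows "valid_test (sup_test \<Phi> B) B"
proof -
  have "sup_test \<Phi> B m m' d \<longleftrightarrow> B \<inter> {real m / real d..real m' / real d} \<noteq> {}"
    if "m < m'" "m' \<le> d" for m m' d
  proof -
    define p q where "p = real m / real d" and "q = real m' / real d"
    have pq: "0 \<le> p" "p \<le> q" "q \<le> 1" using that by (auto simp: p_def q_def divide_simps)
    have "codes (\<lambda>_. rat_code m d) p" "codes (\<lambda>_. rat_code m' d) q"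
      using codes_const[of "rat_code m d"] codes_const[of "rat_code m' d"] by (simp_all add: p_def q_def)
    with \<Phi> pq have "codes (\<Phi> (ind_rep B) (\<lambda>_. ind_rep B) (\<lambda>_. rat_code m d) (\<lambda>_. rat_code m' d))
        (SUP x\<in>{p..q}. indicator B x)"
      using baire2_data_indicator[OF B] codes_data_ind unfolding is_sup_functional_def by blast
    from codes_dist_le[OF this, of 2]
    have "\<bar>rat_of (\<Phi> (ind_rep B) (\<lambda>_. ind_rep B) (\<lambda>_. rat_code m d) (\<lambda>_. rat_code m' d) 2) -
        (SUP x\<in>{p..q}. indicator B x)\<bar> \<le> 1 / 4"
      by simp
    then have "sup_test \<Phi> B m m' d \<longleftrightarrow> (SUP x\<in>{p..q}. indicator B x) > (1 / 2 :: real)"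
      if "(SUP x\<in>{p..q}. indicator B x) \<in> {0, 1 :: real}"
      using that unfolding sup_test_def rat_above_half_iff by (elim insertE emptyE) linarith+
    moreover have "(SUP x\<in>{p..q}. indicator B x) = (if B \<inter> {p..q} \<noteq> {} then 1 else 0 :: real)"
    proof (cases "B \<inter> {p..q} = {}")
      case True
      then have "(SUP x\<in>{p..q}. indicator B x) = (SUP x\<in>{p..q}. 0 :: real)"
        by (intro SUP_cong refl) (auto simp: indicator_def disjoint_iff)
      also have "\<dots> = 0" using pq by (intro cSUP_const) auto
      finally have "(SUP x\<in>{p..q}. indicator B x) = (0 :: real)" .
      then show ?thesis using True by simp
    next
      case False
      then obtain b where "b \<in> B" "b \<in> {p..q}" by blast
      then have "(SUP x\<in>{p..q}. indicator B x) = (1::real)"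
        by (intro cSup_eq_maximum) (auto simp: indicator_def image_iff)
      then show ?thesis using False by simp
    qed
    ultimately show ?thesis by (auto simp: p_def q_def)
  qed
  moreover have "{a<..<b} \<subseteq> {a..b}" for a b :: real by auto
  ultimately show ?thesis unfolding valid_test_def by blast
qed

text \<open>
  The even entries of \<open>w\<close> are rationals converging to a real \<open>x\<close>, the odd ones are moduli: for \<open>n \<ge> N\<close>
  and \<open>j \<ge> w (2 n + 1)\<close> the \<open>(n, j)\<close>-th continuous function is at least about \<open>1 / 2\<close> at \<open>x\<close>, so that its
  iterated limit at \<open>x\<close> is not \<open>0\<close>. Requiring this at stage \<open>k\<close> for indices up to \<open>k\<close> only makes it
  unnecessary to know moduli of continuity.
\<close>

definition approx_node ::
    "(nat \<Rightarrow> nat \<Rightarrow> nat \<Rightarrow> nat) \<Rightarrow> nat \<Rightarrow> nat \<Rightarrow> nat \<Rightarrow> nat \<Rightarrow> type1 \<Rightarrow> nat \<Rightarrow> bool" where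
  "approx_node V N m m' d w k \<longleftrightarrow>
     rat_between (w (k + k)) m m' d \<and>
     (\<forall>i. i \<le> k \<longrightarrow> rat_near (w (i + i)) (w (k + k)) i) \<and>
     (\<forall>n j. n \<le> k \<and> N \<le> n \<and> j \<le> k \<and> w (Suc (n + n)) \<le> j \<longrightarrow> rat_above_half (V n j (w (k + k))))"

definition approx_test :: "approx_functional \<Rightarrow> real set \<Rightarrow> nat \<Rightarrow> nat \<Rightarrow> nat \<Rightarrow> bool" where
  "approx_test \<Psi> B m m' d \<longleftrightarrow>
     (\<exists>N w. \<forall>k. approx_node (\<lambda>n j c. \<Psi> (ind_rep B) (\<lambda>_. ind_rep B) n j (\<lambda>_. c) 3) N m m' d w k)"

text \<open>A point of \<open>B\<close> in the open interval yields a witness by continuity.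
  Conversely the rationals of a witness converge to some \<open>x\<close> where the iterated limit
  is at least \<open>3 / 8\<close>, so the indicator at \<open>x\<close> is not 0. The bounds
  \<open>3 / 4\<close> and \<open>3 / 8\<close> leave room for the error \<open>1 / 8\<close> of
  entry 3 around the threshold \<open>1 / 2\<close>.\<close>

lemma valid_approx_test:
  assumes \<Psi>: "is_approx_functional \<Psi>" and B: "\<And>x y. x \<in> B \<Longrightarrow> y \<in> B \<Longrightarrow> x = y"
  shows "valid_test (approx_test \<Psi> B) B"
proof -
  define V where "V n j c = \<Psi> (ind_rep B) (\<lambda>_. ind_rep B) n j (\<lambda>_. c) 3" for n j c
  have data: "baire2_data (indicator B) (\<lambda>_. indicator B) \<and>
      codes_data (ind_rep B) (\<lambda>_. ind_rep B) (indicator B) (\<lambda>_. indicator B)"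
    using baire2_data_indicator[OF B] codes_data_ind by blast
  obtain g where g: "\<forall>n j. continuous_on {0..1} (g n j) \<and>
      (\<forall>x\<in>{0..1}. \<forall>X. codes X x \<longrightarrow> codes (\<Psi> (ind_rep B) (\<lambda>_. ind_rep B) n j X) (g n j x))"
    and lim: "\<forall>x\<in>{0..1}. \<exists>c. (\<forall>n. (\<lambda>j. g n j x) \<longlonglongrightarrow> c n) \<and> c \<longlonglongrightarrow> indicator B x"
    using \<Psi>[unfolded is_approx_functional_def, rule_format, OF data] by (elim exE conjE)
  have cont: "continuous_on {0..1} (g n j)" for n j using g by blast
  have codes: "codes (\<Psi> (ind_rep B) (\<lambda>_. ind_rep B) n j X) (g n j x)" if "x \<in> {0..1}" "codes X x" for n j x X
    using g that by blast
  have V: "\<bar>rat_of (V n j c) - g n j (rat_of c)\<bar> \<le> 1 / 8" if "rat_of c \<in> {0..1}" for n j c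
    using codes_dist_le[OF codes[OF that codes_const], of n j 3] by (simp add: V_def)
  have "approx_test \<Psi> B m m' d"
    if m: "m < m'" "m' \<le> d" and b: "b \<in> B" "b \<in> {real m / real d<..<real m' / real d}" for m m' d b
  proof -
    define p q where "p = real m / real d" and "q = real m' / real d"
    have pq: "0 \<le> p" "q \<le> 1" using m by (auto simp: p_def q_def divide_simps)
    have bpq: "b \<in> {p<..<q}" using b by (simp add: p_def q_def)
    \<comment> \<open>An interior point of the unit interval, so continuity on the interval is
      ordinary continuity at \<open>b\<close>.\<close>
    then have b01: "b \<in> {0<..<1}" using pq by simp
    obtain c where c: "\<And>n. (\<lambda>j. g n j b) \<longlonglongrightarrow> c n" "c \<longlonglongrightarrow> 1"
      using lim[rule_format, of b] b(1) b01 by force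
    obtain N where N: "\<And>n. n \<ge> N \<Longrightarrow> c n > 3 / 4"
      using order_tendstoD(1)[OF c(2), of "3 / 4"] by (auto simp: eventually_sequentially)
    have "\<exists>M. \<forall>j\<ge>M. g n j b > 3 / 4" if "n \<ge> N" for n
      using order_tendstoD(1)[OF c(1) N[OF that]] by (auto simp: eventually_sequentially)
    then obtain M where M: "\<And>n j. n \<ge> N \<Longrightarrow> j \<ge> M n \<Longrightarrow> g n j b > 3 / 4" by metis
    \<comment> \<open>Stage \<open>k\<close> involves finitely many pairs \<open>n\<close>,
      \<open>j\<close>, so one neighbourhood of \<open>b\<close> serves them all.\<close>
    have "\<exists>r. rat_of r \<in> {p<..<q} \<and> \<bar>rat_of r - b\<bar> < 1 / 2 ^ Suc k \<and>
        (\<forall>n\<in>{N..k}. \<forall>j\<in>{M n..k}. g n j (rat_of r) > 3 / 4)" for k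
    proof -
      have "\<forall>\<^sub>F y in nhds b. g n j y > 3 / 4" if "n \<ge> N" "j \<ge> M n" for n j
      proof -
        have "isCont (g n j) b"
          using cont b01 by (intro continuous_on_interior[of "{0..1}"]) auto
        then show ?thesis
          using M[OF that] by (intro order_tendstoD(1)) (auto simp: isCont_def tendsto_nhds_iff)
      qed
      then have "\<forall>\<^sub>F y in nhds b. \<forall>n\<in>{N..k}. \<forall>j\<in>{M n..k}. g n j y > 3 / 4"
        by (intro eventually_ball_finite ballI) auto
      moreover have "\<forall>\<^sub>F y in nhds b. y \<in> {p<..<q}"
        using bpq by (intro eventually_nhds_in_open) auto
      moreover have "\<forall>\<^sub>F y in nhds b. y \<in> ball b (1 / 2 ^ Suc k)"
        by (intro eventually_nhds_in_open) auto
      ultimately have "\<forall>\<^sub>F y in nhds b. y \<in> {p<..<q} \<and> y \<in> ball b (1 / 2 ^ Suc k) \<and>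
          (\<forall>n\<in>{N..k}. \<forall>j\<in>{M n..k}. g n j y > 3 / 4)"
        by (intro eventually_conj)
      then obtain e where e: "e > 0" "\<And>y. dist y b < e \<Longrightarrow> y \<in> {p<..<q} \<and> y \<in> ball b (1 / 2 ^ Suc k) \<and>
          (\<forall>n\<in>{N..k}. \<forall>j\<in>{M n..k}. g n j y > 3 / 4)"
        unfolding eventually_nhds_metric by blast
      obtain r where "b < rat_of r" "rat_of r < b + e" using rat_of_dense[of b "b + e"] e(1) by auto
      then have "dist (rat_of r) b < e" by (simp add: dist_real_def)
      from e(2)[OF this] show ?thesis
        by (intro exI[of _ r]) (simp add: dist_real_def abs_minus_commute)
    qed
    then obtain r where r: "\<And>k. rat_of (r k) \<in> {p<..<q}" "\<And>k. \<bar>rat_of (r k) - b\<bar> < 1 / 2 ^ Suc k"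
      "\<And>k n j. n \<in> {N..k} \<Longrightarrow> j \<in> {M n..k} \<Longrightarrow> g n j (rat_of (r k)) > 3 / 4" by metis
    define w where "w i = (if even i then r (i div 2) else M (i div 2))" for i
    have w: "w (k + k) = r k" "w (Suc (k + k)) = M k" for k
      by (simp_all add: w_def)
    have "approx_node V N m m' d w k" for k
      unfolding approx_node_def w
    proof (intro conjI allI impI)
      show "rat_between (r k) m m' d"
        using r(1)[of k] m by (simp add: rat_between_iff p_def q_def)
      show "rat_near (r i) (r k) i" if "i \<le> k" for i
      proof -
        \<comment> \<open>Both points are compared with \<open>b\<close>; the exponents
          \<open>Suc k\<close> and \<open>Suc i\<close> make the two errors add up to at most
          \<open>1 / 2 ^ i\<close>.\<close>
        have "(1::real) / 2 ^ Suc k \<le> 1 / 2 ^ Suc i" using that by (intro divide_left_mono power_increasing) auto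
        moreover have "(1::real) / 2 ^ Suc i + 1 / 2 ^ Suc i = 1 / 2 ^ i" by (simp add: field_simps)
        ultimately show ?thesis using r(2)[of i] r(2)[of k] unfolding rat_near_iff by linarith
      qed
      show "rat_above_half (V n j (r k))" if "n \<le> k \<and> N \<le> n \<and> j \<le> k \<and> M n \<le> j" for n j
      proof -
        have "rat_of (r k) \<in> {0..1}" using r(1)[of k] pq by simp
        from V[OF this, of n j] have "\<bar>rat_of (V n j (r k)) - g n j (rat_of (r k))\<bar> \<le> 1 / 8" .
        moreover have "g n j (rat_of (r k)) > 3 / 4" using r(3)[of n k j] that by simp
        ultimately show ?thesis unfolding rat_above_half_iff by linarith
      qed
    qed
    then show ?thesis unfolding approx_test_def V_def by blast
  qed
  moreover have "B \<inter> {real m / real d..real m' / real d} \<noteq> {}"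
    if m: "m < m'" "m' \<le> d" and t: "approx_test \<Psi> B m m' d" for m m' d
  proof -
    define p q where "p = real m / real d" and "q = real m' / real d"
    have pq: "0 \<le> p" "q \<le> 1" using m by (auto simp: p_def q_def divide_simps)
    obtain N w where w: "\<And>k. approx_node V N m m' d w k"
      using t unfolding approx_test_def V_def by blast
    define r where "r k = w (k + k)" for k
    have r: "rat_of (r k) \<in> {p..q}" for k
      using w[of k] m by (auto simp: approx_node_def rat_between_iff r_def p_def q_def)
    have r01: "rat_of (r k) \<in> {0..1}" for k
      using r[of k] pq by simp
    \<comment> \<open>The proximity conditions of all stages say exactly that the even entries form
      a code.\<close>
    have "is_code r"
      using w by (auto simp: is_code_def approx_node_def r_def)
    then obtain x where "codes r x" by (auto simp: is_code_iff)
    then have x: "(\<lambda>k. rat_of (r k)) \<longlonglongrightarrow> x"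
      by (simp add: codes_def rat_seq_rat_of[abs_def])
    have xpq: "x \<in> {p..q}"
      using r x by (rule closed_sequentially[OF closed_atLeastAtMost])
    then have x01: "x \<in> {0..1}" using pq by auto
    have "g n j x \<ge> 3 / 8" if "n \<ge> N" "j \<ge> w (Suc (n + n))" for n j
    proof -
      \<comment> \<open>A fixed pair \<open>n\<close>, \<open>j\<close> is checked at all stages
        from \<open>max n j\<close> on, so its bound passes to the limit by continuity.\<close>
      have "g n j (rat_of (r k)) \<ge> 3 / 8" if "k \<ge> max n j" for k
      proof -
        have "rat_above_half (V n j (r k))"
          using w[of k] that \<open>n \<ge> N\<close> \<open>j \<ge> w (Suc (n + n))\<close> by (auto simp: approx_node_def r_def)
        then show ?thesis
          using V[OF r01[of k], of n j] unfolding rat_above_half_iff by linarith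
      qed
      moreover have "(\<lambda>k. g n j (rat_of (r k))) \<longlonglongrightarrow> g n j x"
        using x01 r01 by (intro continuous_on_tendsto_compose[OF cont x] always_eventually) auto
      ultimately show ?thesis by (intro LIMSEQ_le_const exI[of _ "max n j"]) auto
    qed
    moreover obtain c where c: "\<And>n. (\<lambda>j. g n j x) \<longlonglongrightarrow> c n" "c \<longlonglongrightarrow> indicator B x"
      using lim x01 by blast
    ultimately have "c n \<ge> 3 / 8" if "n \<ge> N" for n
      using that by (intro LIMSEQ_le_const[OF c(1)]) blast
    then have "indicator B x \<ge> (3 / 8 :: real)"
      by (intro LIMSEQ_le_const[OF c(2)]) blast
    then have "x \<in> B" by (cases "x \<in> B") simp_all
    then show ?thesis using xpq by (auto simp: p_def q_def)
  qed
  ultimately show ?thesis unfolding valid_test_def by blast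
qed

section \<open>Self-indexing sets of reals\<close>

text \<open>\<open>T i Z\<close> is the object with index \<open>i\<close> relative to the oracle \<open>Z\<close>.\<close>

lemma maximal_self_indexing:
  fixes T :: "'i \<Rightarrow> ('a \<Rightarrow> 'i option) \<Rightarrow> 'a"
  obtains Y where
    "\<And>x i Z. Y x = Some i \<Longrightarrow> Y \<subseteq>\<^sub>m Z \<Longrightarrow> T i Z = x"
    "\<And>i x. (\<And>Z. Y \<subseteq>\<^sub>m Z \<Longrightarrow> T i Z = x) \<Longrightarrow> x \<in> dom Y"
proof -
  \<comment> \<open>Quantifying over all extensions \<open>Z\<close> makes the condition stable
    under unions of chains: an extension of the union extends every member.\<close>
  define good where "good Y \<longleftrightarrow> (\<forall>x i Z. Y x = Some i \<longrightarrow> Y \<subseteq>\<^sub>m Z \<longrightarrow> T i Z = x)" for Y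
  define graphs where "graphs = {Map.graph Y |Y. good Y}"
  have sub: "Map.graph Y \<subseteq> Map.graph Z \<longleftrightarrow> Y \<subseteq>\<^sub>m Z" for Y Z :: "'a \<Rightarrow> 'i option"
  proof -
    have "Map.graph Y \<subseteq> Map.graph Z \<longleftrightarrow> (\<forall>x i. Y x = Some i \<longrightarrow> Z x = Some i)"
      unfolding Map.graph_def by blast
    also have "\<dots> \<longleftrightarrow> Y \<subseteq>\<^sub>m Z" unfolding map_le_def by (metis domD domI)
    finally show ?thesis .
  qed
  have "\<exists>M\<in>graphs. \<forall>X\<in>graphs. M \<subseteq> X \<longrightarrow> X = M"
  proof (rule subset_Zorn_nonempty)
    have "good Map.empty" by (simp add: good_def)
    then show "graphs \<noteq> {}" by (auto simp: graphs_def)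
  next
    fix C assume C: "C \<noteq> {}" "subset.chain graphs C"
    have graph: "\<exists>Y. good Y \<and> g = Map.graph Y" if "g \<in> C" for g
      using C(2) that by (auto simp: subset_chain_def graphs_def)
    define Y where "Y x = (if \<exists>i. (x, i) \<in> \<Union>C then Some (SOME i. (x, i) \<in> \<Union>C) else None)" for x
    have unique: "i = j" if ij: "(x, i) \<in> \<Union>C" "(x, j) \<in> \<Union>C" for x i j
    proof -
      obtain g where "g \<in> C" "(x, i) \<in> g" "(x, j) \<in> g"
        using C(2) ij unfolding subset_chain_def by blast
      then show ?thesis using graph[of g] by (auto simp: Map.graph_def)
    qed
    have Y: "Y x = Some i \<longleftrightarrow> (x, i) \<in> \<Union>C" for x i
    proof (cases "\<exists>j. (x, j) \<in> \<Union>C")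
      case True
      then have "(x, SOME j. (x, j) \<in> \<Union>C) \<in> \<Union>C" by (rule someI_ex)
      moreover have "Y x = Some (SOME j. (x, j) \<in> \<Union>C)" using True unfolding Y_def by (rule if_P)
      ultimately show ?thesis using unique by (metis option.inject)
    next
      case False
      then show ?thesis unfolding Y_def by simp
    qed
    have "good Y"
      unfolding good_def
    proof (intro allI impI)
      fix x i Z assume "Y x = Some i" and Z: "Y \<subseteq>\<^sub>m Z"
      then obtain g where g: "g \<in> C" "(x, i) \<in> g" by (auto simp: Y)
      then obtain Y' where Y': "good Y'" "g = Map.graph Y'" using graph by blast
      have "Y x = Some i" if "Y' x = Some i" for x i
        using that g(1) Y'(2) unfolding Y Map.graph_def by blast
      then have "Y' \<subseteq>\<^sub>m Y" unfolding map_le_def by (metis domD)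
      then have "Y' \<subseteq>\<^sub>m Z" using Z by (rule map_le_trans)
      moreover have "Y' x = Some i" using Y'(2) g(2) by (simp add: Map.graph_def)
      ultimately show "T i Z = x" using Y'(1) unfolding good_def by blast
    qed
    moreover have "\<Union>C = Map.graph Y" by (auto simp: Map.graph_def Y)
    ultimately show "\<Union>C \<in> graphs" by (auto simp: graphs_def)
  qed
  then obtain M where M: "M \<in> graphs" and max': "\<And>X. X \<in> graphs \<Longrightarrow> M \<subseteq> X \<Longrightarrow> X = M" by blast
  from M obtain Y where Y: "good Y" and MY: "M = Map.graph Y" by (auto simp: graphs_def)
  have max: "Z = Y" if "good Z" "Y \<subseteq>\<^sub>m Z" for Z
  proof -
    have "Map.graph Z = M" using that by (intro max') (auto simp: graphs_def MY sub)
    then have "Z \<subseteq>\<^sub>m Y" by (simp flip: sub add: MY)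
    with that(2) show ?thesis by (intro map_le_antisym)
  qed
  \<comment> \<open>Otherwise \<open>x\<close> could be added with index \<open>i\<close>:
    extensions of the enlarged map extend \<open>Y\<close>, so the enlarged map is still
    good.\<close>
  have "x \<in> dom Y" if T: "\<And>Z. Y \<subseteq>\<^sub>m Z \<Longrightarrow> T i Z = x" for i x
  proof (rule ccontr)
    assume x: "x \<notin> dom Y"
    then have le: "Y \<subseteq>\<^sub>m Y(x \<mapsto> i)" by (auto simp: map_le_def)
    have "good (Y(x \<mapsto> i))"
      unfolding good_def
    proof (intro allI impI)
      fix x' i' Z assume x': "(Y(x \<mapsto> i)) x' = Some i'" and "Y(x \<mapsto> i) \<subseteq>\<^sub>m Z"
      then have "Y \<subseteq>\<^sub>m Z" using le map_le_trans by blast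
      then show "T i' Z = x'"
        using T x' Y unfolding good_def by (cases "x' = x") auto
    qed
    from max[OF this le] show False using x by (metis domIff fun_upd_same option.distinct(1))
  qed
  with Y that show thesis unfolding good_def by blast
qed

section \<open>Computations relative to extensions of a self-indexing\<close>

definition level :: "(real \<Rightarrow> 'i::countable option) \<Rightarrow> nat \<Rightarrow> real set" where
  "level Z n = {x. map_option to_nat (Z x) = Some n}"

lemma level_subsingleton:
  assumes "inj_on Y (dom Y)" "x \<in> level Y n" "y \<in> level Y n"
  shows "x = y"
proof -
  obtain i j where "Y x = Some i" "Y y = Some j" "to_nat i = to_nat j"
    using assms(2,3) by (auto simp: level_def)
  then show ?thesis using assms(1) by (metis domI inj_onD to_nat_split from_nat_to_nat)
qed

text \<open>S6 permutes and S9 truncates the list of type 2 arguments, so the lists that arise in a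
  computation are described by lists of tags.\<close>

fun ind_functional :: "type2 \<Rightarrow> real set \<Rightarrow> nat \<Rightarrow> type2" where
  "ind_functional S B 0 = S"
| "ind_functional S B (Suc 0) = flat_fun (ind_rep B)"
| "ind_functional S B (Suc (Suc _)) = flat_seq (\<lambda>_. ind_rep B)"

lemma to_front_map: "k < length xs \<Longrightarrow> to_front k (map f xs) = map f (to_front k xs)"
  by (simp add: to_front_def take_map drop_map)

text \<open>Induction on the computation. Only S8 consults the oracle, at a function
  \<open>h\<close> that is itself computed; by induction \<open>h\<close> is the same for all sets
  in \<open>BB\<close>, and \<open>closed\<close> makes the answers agree. Without type 3 arguments
  no scheme adds a type 1 argument, so these remain constant functions.\<close>

lemma kleene_oracle_cong_aux:
  assumes "kleene e as fs Fs Gs v" "Gs = []" "fs = map (\<lambda>c _. c) cs" "B' \<in> BB"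
  assumes closed: "\<And>d as cs pat h j x B'.
      (\<And>a B'. B' \<in> BB \<Longrightarrow> kleene d (a # as) (map (\<lambda>c _. c) cs) (map (ind_functional S B') pat) [] (h a)) \<Longrightarrow>
      codes (\<lambda>i. h (i + j)) x \<Longrightarrow> B' \<in> BB \<Longrightarrow> x \<in> B' \<longleftrightarrow> x \<in> B"
  shows "\<forall>pat. Fs = map (ind_functional S B) pat \<longrightarrow> kleene e as fs (map (ind_functional S B') pat) [] v"
  using assms(1-4)
proof (induction arbitrary: cs B' rule: kleene.induct)
  case (S4 d as fs Fs Gs u c v)
  then show ?case by (blast intro: kleene.S4)
next
  case (S5_Suc c d a as fs Fs Gs u v)
  then show ?case by (blast intro: kleene.S5_Suc)
next
  case (S6_1 k fs d as Fs Gs v)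
  then show ?case by (auto intro!: kleene.S6_1 simp: to_front_map simp del: list_encode.simps One_nat_def)
next
  case (S6_2 k Fs d as fs Gs v)
  then show ?case by (auto intro!: kleene.S6_2 simp: to_front_map simp del: list_encode.simps)
next
  case (S8_2 d as fs F Fs Gs h)
  show ?case
  proof (intro allI impI)
    fix pat assume Fs: "F # Fs = map (ind_functional S B) pat"
    then obtain i pat' where pat: "pat = i # pat'" "F = ind_functional S B i" "Fs = map (ind_functional S B) pat'"
      by auto
    have h: "kleene d (a # as) fs (map (ind_functional S B') pat) [] (h a)" if "B' \<in> BB" for a B'
      by (rule S8_2.IH[OF S8_2.prems(1,2) that, rule_format, OF Fs])
    \<comment> \<open>The shift \<open>j\<close> is there because \<open>flat_fun\<close> and
      \<open>flat_seq\<close> strip one or two leading entries from the queried function.\<close>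
    have "x \<in> B' \<longleftrightarrow> x \<in> B" if "codes (\<lambda>i. h (i + j)) x" for x j
    proof (rule closed[OF _ that \<open>B' \<in> BB\<close>])
      show "kleene d (a # as) (map (\<lambda>c _. c) cs) (map (ind_functional S B') pat) [] (h a)"
        if "B' \<in> BB" for a B'
        using h[OF that] S8_2.prems(2) by (simp only:)
    qed
    then have "(\<exists>x\<in>B'. codes (\<lambda>i. h (i + j)) x) \<longleftrightarrow> (\<exists>x\<in>B. codes (\<lambda>i. h (i + j)) x)" for j
      by blast
    then have "ind_rep B' (\<lambda>i. h (i + j)) = ind_rep B (\<lambda>i. h (i + j))" for j
      unfolding ind_rep_def by simp
    then have eq: "ind_functional S B' i h = F h"
      unfolding pat(2) by (cases "(S, B', i)" rule: ind_functional.cases)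
        (auto simp: flat_fun_def flat_seq_def simp del: add_2_eq_Suc' One_nat_def)
    have "kleene (list_encode [8, 2, d]) as fs (ind_functional S B' i # map (ind_functional S B') pat') []
        (ind_functional S B' i h)"
      by (rule kleene.S8_2) (use h[OF \<open>B' \<in> BB\<close>] in \<open>simp only: pat(1) list.map\<close>)
    then show "kleene (list_encode [8, 2, d]) as fs (map (ind_functional S B') pat) [] (F h)"
      unfolding pat(1) list.map eq .
  qed
next
  case (S9 m0 as m1 fs m2 Fs m3 Gs d v)
  have "kleene d (take m0 as) (take m1 fs) (map (ind_functional S B') (take m2 pat)) [] v"
    if "Fs = map (ind_functional S B) pat" for pat
    using S9.IH[of "take m1 cs"] S9.prems that by (simp add: take_map)
  then show ?case using S9 by (auto intro!: kleene.S9 simp: take_map simp del: list_encode.simps)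
next
  case (S7 a as f fs Fs Gs)
  then show ?case using kleene.S7[of a as f fs] by simp
qed (simp_all add: kleene.S1 kleene.S2 kleene.S3 kleene.S5_zero kleene.S6_0 del: list_encode.simps One_nat_def)

lemmas kleene_oracle_cong = kleene_oracle_cong_aux[rule_format]

text \<open>The index \<open>None\<close> stands for the escaping real, the other ones for the reals about which an oracle is asked.\<close>

type_synonym query = "(nat \<times> nat \<times> nat list \<times> nat list \<times> nat list \<times> nat) option"

text \<open>Assumption \<open>t\<close> says that a test is determined by the computations from the
  representing functionals at constant type 1 arguments. This is the form in which computability of
  a functional enters.\<close>

lemma no_test_computable:
  fixes S :: type2 and t :: "real set \<Rightarrow> nat \<Rightarrow> nat \<Rightarrow> nat \<Rightarrow> bool"
  assumes valid: "\<And>B. (\<And>x y. x \<in> B \<Longrightarrow> y \<in> B \<Longrightarrow> x = y) \<Longrightarrow> valid_test (t B) B"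
    and t: "\<And>B B'. (\<And>as cs e v. kleene e as (map (\<lambda>c _. c) cs) [S, flat_fun (ind_rep B), flat_seq (\<lambda>_. ind_rep B)] [] v \<Longrightarrow>
        kleene e as (map (\<lambda>c _. c) cs) [S, flat_fun (ind_rep B'), flat_seq (\<lambda>_. ind_rep B')] [] v) \<Longrightarrow> t B = t B'"
  shows False
proof -
  \<comment> \<open>A query lists the level asked about, the program \<open>d\<close> of the queried
    function with its arguments and tags, and the shift.\<close>
  define T :: "query \<Rightarrow> (real \<Rightarrow> query option) \<Rightarrow> real"
    where "T i Z = (case i of None \<Rightarrow> escape_real (\<lambda>n. t (level Z n))
      | Some (n, d, as, cs, pat, j) \<Rightarrow> THE x. codes (\<lambda>i. THE v.
          kleene d ((i + j) # as) (map (\<lambda>c _. c) cs) (map (ind_functional S (level Z n)) pat) [] v) x)" for i Z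
  obtain Y where Y: "\<And>x i Z. Y x = Some i \<Longrightarrow> Y \<subseteq>\<^sub>m Z \<Longrightarrow> T i Z = x"
    and max: "\<And>i x. (\<And>Z. Y \<subseteq>\<^sub>m Z \<Longrightarrow> T i Z = x) \<Longrightarrow> x \<in> dom Y"
    using maximal_self_indexing[of T] by blast
  \<comment> \<open>\<open>T\<close> recovers a point from its index relative to \<open>Y\<close>
    itself, so equal indices belong to equal points.\<close>
  have inj: "inj_on Y (dom Y)"
    using Y[OF _ map_le_refl] by (metis domD inj_onI)
  note sing = level_subsingleton[OF inj]
  \<comment> \<open>The queried real is the value of one index relative to every extension, so it
    lies in \<open>dom Y\<close>, where all extensions agree with \<open>Y\<close>.\<close>
  have closed: "x \<in> B' \<longleftrightarrow> x \<in> level Y n"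
    if h: "\<And>a B'. B' \<in> {level Z n |Z. Y \<subseteq>\<^sub>m Z} \<Longrightarrow>
        kleene d (a # as) (map (\<lambda>c _. c) cs) (map (ind_functional S B') pat) [] (h a)"
      and x: "codes (\<lambda>i. h (i + j)) x" and B': "B' \<in> {level Z n |Z. Y \<subseteq>\<^sub>m Z}"
    for n d as cs pat h j x B'
  proof -
    have "T (Some (n, d, as, cs, pat, j)) Z = x" if "Y \<subseteq>\<^sub>m Z" for Z
    proof -
      have "kleene d (a # as) (map (\<lambda>c _. c) cs) (map (ind_functional S (level Z n)) pat) [] (h a)" for a
        using h that by blast
      then have "(THE v. kleene d (a # as) (map (\<lambda>c _. c) cs) (map (ind_functional S (level Z n)) pat) [] v) = h a" for a
        using kleene_deterministic by blast
      then show ?thesis using x codes_unique unfolding T_def by auto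
    qed
    then have "x \<in> dom Y" by (rule max)
    moreover obtain Z where "B' = level Z n" "Y \<subseteq>\<^sub>m Z" using B' by blast
    ultimately have "Z x = Y x" "B' = level Z n" by (simp_all add: map_le_def)
    then show ?thesis by (simp add: level_def)
  qed
  have "t (level Y n) = t (level Z n)" if Z: "Y \<subseteq>\<^sub>m Z" for n Z
  proof (rule t)
    fix as cs e v
    assume "kleene e as (map (\<lambda>c _. c) cs)
      [S, flat_fun (ind_rep (level Y n)), flat_seq (\<lambda>_. ind_rep (level Y n))] [] v"
    from kleene_oracle_cong[OF this refl refl, of "level Z n" "{level Z n |Z. Y \<subseteq>\<^sub>m Z}" S "level Y n" "[0, 1, 2]"]
    show "kleene e as (map (\<lambda>c _. c) cs)
      [S, flat_fun (ind_rep (level Z n)), flat_seq (\<lambda>_. ind_rep (level Z n))] [] v"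
      using closed[where n = n] Z by (auto simp: numeral_2_eq_2)
  qed
  \<comment> \<open>Equal tests give the same escaping real for every extension; maximality puts it
    into a level, which it avoids by construction.\<close>
  then have "T None Z = escape_real (\<lambda>n. t (level Y n))" if "Y \<subseteq>\<^sub>m Z" for Z
    using that by (simp add: T_def)
  then have "escape_real (\<lambda>n. t (level Y n)) \<in> dom Y" by (rule max)
  then obtain n where "escape_real (\<lambda>n. t (level Y n)) \<in> level Y n"
    by (auto simp: level_def)
  then show False
    using escape_real_notin[of "\<lambda>n. t (level Y n)" n "level Y n"] valid[of "level Y n"] sing by blast
qed

section \<open>Non-computability of the two functionals\<close>

lemma sup_not_computable:
  assumes "is_sup_functional \<Phi>"
  shows "\<not> sup_computable_in \<Phi> S"
proof
  assume "sup_computable_in \<Phi> S"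
  then obtain e where e: "\<And>f fs F Fs p q P Q l. codes_data F Fs f fs \<Longrightarrow> codes P p \<Longrightarrow> codes Q q \<Longrightarrow>
      kleene e [l] [P, Q] [S, flat_fun F, flat_seq Fs] [] (\<Phi> F Fs P Q l)"
    unfolding sup_computable_in_def by blast
  \<comment> \<open>The test consults \<Phi> only at constant codes, as the transfer of computations
    requires.\<close>
  have k: "kleene e [2] (map (\<lambda>c _. c) [c, c']) [S, flat_fun (ind_rep B), flat_seq (\<lambda>_. ind_rep B)] []
      (\<Phi> (ind_rep B) (\<lambda>_. ind_rep B) (\<lambda>_. c) (\<lambda>_. c') 2)" for B c c'
    using e[OF codes_data_ind codes_const codes_const] by simp
  show False
  proof (rule no_test_computable[where S = S and t = "sup_test \<Phi>"])
    show "valid_test (sup_test \<Phi> B) B" if "\<And>x y. x \<in> B \<Longrightarrow> y \<in> B \<Longrightarrow> x = y" for B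
      using valid_sup_test assms that by blast
  next
    fix B B'
    assume transfer: "\<And>as cs e v. kleene e as (map (\<lambda>c _. c) cs) [S, flat_fun (ind_rep B), flat_seq (\<lambda>_. ind_rep B)] [] v \<Longrightarrow>
      kleene e as (map (\<lambda>c _. c) cs) [S, flat_fun (ind_rep B'), flat_seq (\<lambda>_. ind_rep B')] [] v"
    show "sup_test \<Phi> B = sup_test \<Phi> B'"
      unfolding sup_test_def[abs_def] kleene_deterministic[OF transfer[OF k] k] ..
  qed
qed

lemma approx_not_computable:
  assumes "is_approx_functional \<Psi>"
  shows "\<not> approx_computable_in \<Psi> S"
proof
  assume "approx_computable_in \<Psi> S"
  then obtain e where e: "\<And>f fs F Fs x X n m l. codes_data F Fs f fs \<Longrightarrow> codes X x \<Longrightarrow>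
      kleene e [n, m, l] [X] [S, flat_fun F, flat_seq Fs] [] (\<Psi> F Fs n m X l)"
    unfolding approx_computable_in_def by blast
  have k: "kleene e [n, m, 3] (map (\<lambda>c _. c) [c]) [S, flat_fun (ind_rep B), flat_seq (\<lambda>_. ind_rep B)] []
      (\<Psi> (ind_rep B) (\<lambda>_. ind_rep B) n m (\<lambda>_. c) 3)" for B n m c
    using e[OF codes_data_ind codes_const] by simp
  show False
  proof (rule no_test_computable[where S = S and t = "approx_test \<Psi>"])
    show "valid_test (approx_test \<Psi> B) B" if "\<And>x y. x \<in> B \<Longrightarrow> y \<in> B \<Longrightarrow> x = y" for B
      using valid_approx_test assms that by blast
  next
    fix B B'
    assume transfer: "\<And>as cs e v. kleene e as (map (\<lambda>c _. c) cs) [S, flat_fun (ind_rep B), flat_seq (\<lambda>_. ind_rep B)] [] v \<Longrightarrow>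
      kleene e as (map (\<lambda>c _. c) cs) [S, flat_fun (ind_rep B'), flat_seq (\<lambda>_. ind_rep B')] [] v"
    show "approx_test \<Psi> B = approx_test \<Psi> B'"
      unfolding approx_test_def[abs_def] kleene_deterministic[OF transfer[OF k] k] ..
  qed
qed

section \<open>Computability in the Suslin functional\<close>

type_synonym env = "type2 \<times> type2 \<times> type3"

text \<open>
  The \<open>i\<close>-th variable of type 0 is kept at position \<open>\<rho> i\<close> of the argument list, that of type 1 at position
  \<open>\<sigma> i\<close>. As \<open>\<rho>\<close> and \<open>\<sigma>\<close> are arbitrary, indices need not be adapted when arguments are added in front.
\<close>

definition fits :: "nat \<Rightarrow> (nat \<Rightarrow> nat) \<Rightarrow> 'a list \<Rightarrow> (nat \<Rightarrow> 'a) \<Rightarrow> bool" where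
  "fits N \<rho> xs v \<longleftrightarrow> (\<forall>i<N. \<rho> i < length xs \<and> xs ! \<rho> i = v i)"

definition computes :: "nat \<Rightarrow> nat \<Rightarrow> (nat \<Rightarrow> nat) \<Rightarrow> (nat \<Rightarrow> nat) \<Rightarrow> nat \<Rightarrow>
    (env \<Rightarrow> (nat \<Rightarrow> nat) \<Rightarrow> (nat \<Rightarrow> type1) \<Rightarrow> nat) \<Rightarrow> bool" where
  "computes N M \<rho> \<sigma> e \<phi> \<longleftrightarrow> (\<forall>a y G as fs v g. fits N \<rho> as v \<longrightarrow> fits M \<sigma> fs g \<longrightarrow>
     kleene e as fs [suslin, a, y] [G] (\<phi> (a, y, G) v g))"

text \<open>
  The environment consists of two type 2 arguments besides \<open>suslin\<close> and of a type 3 argument; \<open>M\<close> is the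
  number of available variables of type 1.
\<close>

definition computable :: "nat \<Rightarrow> (env \<Rightarrow> (nat \<Rightarrow> nat) \<Rightarrow> (nat \<Rightarrow> type1) \<Rightarrow> nat) \<Rightarrow> bool" where
  "computable M \<phi> \<longleftrightarrow> (\<exists>N. \<forall>\<rho> \<sigma>. \<exists>e. computes N M \<rho> \<sigma> e \<phi>)"

abbreviation decidable :: "nat \<Rightarrow> (env \<Rightarrow> (nat \<Rightarrow> nat) \<Rightarrow> (nat \<Rightarrow> type1) \<Rightarrow> bool) \<Rightarrow> bool" where
  "decidable M P \<equiv> computable M (\<lambda>E v g. of_bool (P E v g))"

named_theorems comp_intros

lemma computesI:
  assumes "\<And>a y G as fs v g. fits N \<rho> as v \<Longrightarrow> fits M \<sigma> fs g \<Longrightarrow>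
     kleene e as fs [suslin, a, y] [G] (\<phi> (a, y, G) v g)"
  shows "computes N M \<rho> \<sigma> e \<phi>"
  using assms unfolding computes_def by blast

lemma computableI:
  assumes "\<And>\<rho> \<sigma>. computes N M \<rho> \<sigma> (e \<rho> \<sigma>) \<phi>"
  shows "computable M \<phi>"
  using assms unfolding computable_def by blast

lemma computesD:
  assumes "computes N M \<rho> \<sigma> e \<phi>" "fits N \<rho> as v" "fits M \<sigma> fs g"
  shows "kleene e as fs [suslin, a, y] [G] (\<phi> (a, y, G) v g)"
  using assms unfolding computes_def by blast

lemma fits_Cons: "fits N \<rho> xs v \<Longrightarrow> fits (Suc N) (case_nat 0 (\<lambda>i. Suc (\<rho> i))) (x # xs) (case_nat x v)"
  by (auto simp: fits_def split: nat.split)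

lemma fits_mono: "fits N \<rho> xs v \<Longrightarrow> N' \<le> N \<Longrightarrow> fits N' \<rho> xs v"
  by (auto simp: fits_def)

lemma to_front_fits:
  assumes "fits N \<rho> xs v" "k < N"
  shows "\<rho> k < length xs" "to_front (\<rho> k) xs = v k # take (\<rho> k) xs @ drop (Suc (\<rho> k)) xs"
  using assms by (auto simp: fits_def to_front_def)

section \<open>Closure under substitution and the schemes\<close>

lemma computable_var [comp_intros]: "computable M (\<lambda>E v g. v k)"
proof (rule computableI)
  fix \<rho> \<sigma> :: "nat \<Rightarrow> nat"
  show "computes (Suc k) M \<rho> \<sigma> (list_encode [6, 0, \<rho> k, list_encode [3]]) (\<lambda>E v g. v k)"
  proof (intro computesI kleene.S6_0)
    fix as and v :: "nat \<Rightarrow> nat" and a y G and fs :: "type1 list" assume "fits (Suc k) \<rho> as v"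
    note f = to_front_fits[OF this lessI]
    show "\<rho> k < length as" by (rule f(1))
    show "kleene (list_encode [3]) (to_front (\<rho> k) as) fs [suslin, a, y] [G] (v k)"
      unfolding f(2) by (rule kleene.S3)
  qed
qed

lemma computable_const [comp_intros]: "computable M (\<lambda>E v g. k)"
  by (rule computableI[where N = 0 and e = "\<lambda>\<rho> \<sigma>. list_encode [2, k]"], rule computesI, rule kleene.S2)

text \<open>S4 places the value of \<open>t\<close> at the head of the arguments. This binds a
  variable there and moves the others up by one; all substitutions are reduced to it.\<close>

lemma computable_push:
  assumes F: "computable M (\<lambda>E v g. F E (\<lambda>i. v (Suc i)) g (v 0))" and t: "computable M t"
  shows "computable M (\<lambda>E v g. F E v g (t E v g))"
proof -
  obtain N1 where N1: "\<And>\<rho> \<sigma>. \<exists>e. computes N1 M \<rho> \<sigma> e (\<lambda>E v g. F E (\<lambda>i. v (Suc i)) g (v 0))"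
    using F unfolding computable_def by blast
  obtain N2 where N2: "\<And>\<rho> \<sigma>. \<exists>e. computes N2 M \<rho> \<sigma> e t"
    using t unfolding computable_def by blast
  show ?thesis
    unfolding computable_def
  proof (rule exI[of _ "max N1 N2"], intro allI)
    fix \<rho> \<sigma> :: "nat \<Rightarrow> nat"
    obtain c where c: "computes N1 M (case_nat 0 (\<lambda>i. Suc (\<rho> i))) \<sigma> c (\<lambda>E v g. F E (\<lambda>i. v (Suc i)) g (v 0))"
      using N1 by blast
    obtain d where d: "computes N2 M \<rho> \<sigma> d t" using N2 by blast
    have "computes (max N1 N2) M \<rho> \<sigma> (list_encode [4, c, d]) (\<lambda>E v g. F E v g (t E v g))"
    proof (intro computesI kleene.S4)
      fix as and v :: "nat \<Rightarrow> nat" and a y G and fs :: "type1 list" and g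
      assume v: "fits (max N1 N2) \<rho> as v" and g: "fits M \<sigma> fs g"
      let ?u = "t (a, y, G) v g"
      show "kleene d as fs [suslin, a, y] [G] ?u"
        by (rule computesD[OF d fits_mono[OF v] g]) simp
      have "fits N1 (case_nat 0 (\<lambda>i. Suc (\<rho> i))) (?u # as) (case_nat ?u v)"
        by (rule fits_mono[OF fits_Cons[OF v]]) simp
      from computesD[OF c this g, of a y G]
      show "kleene c (?u # as) fs [suslin, a, y] [G] (F (a, y, G) v g ?u)" by simp
    qed
    then show "\<exists>e. computes (max N1 N2) M \<rho> \<sigma> e (\<lambda>E v g. F E v g (t E v g))" by blast
  qed
qed

lemma computable_rename:
  assumes "computable M \<phi>"
  shows "computable M (\<lambda>E v g. \<phi> E (\<lambda>i. v (r i)) g)"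
proof -
  obtain N where N: "\<And>\<rho> \<sigma>. \<exists>e. computes N M \<rho> \<sigma> e \<phi>"
    using assms unfolding computable_def by blast
  \<comment> \<open>The sum bounds every position \<open>r i\<close> with \<open>i < N\<close>, so
    enough variables are available.\<close>
  have r: "r i < Suc (\<Sum>i<N. r i)" if "i < N" for i
    using that by (intro le_imp_less_Suc member_le_sum) auto
  show ?thesis
    unfolding computable_def
  proof (rule exI[of _ "Suc (\<Sum>i<N. r i)"], intro allI)
    fix \<rho> \<sigma> :: "nat \<Rightarrow> nat"
    obtain e where e: "computes N M (\<lambda>i. \<rho> (r i)) \<sigma> e \<phi>" using N by blast
    have "computes (Suc (\<Sum>i<N. r i)) M \<rho> \<sigma> e (\<lambda>E v g. \<phi> E (\<lambda>i. v (r i)) g)"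
    proof (rule computesI)
      fix as and v :: "nat \<Rightarrow> nat" and a y G and fs :: "type1 list" and g
      assume v: "fits (Suc (\<Sum>i<N. r i)) \<rho> as v" and g: "fits M \<sigma> fs g"
      have "fits N (\<lambda>i. \<rho> (r i)) as (\<lambda>i. v (r i))"
        using v r by (auto simp: fits_def)
      from computesD[OF e this g]
      show "kleene e as fs [suslin, a, y] [G] (\<phi> (a, y, G) (\<lambda>i. v (r i)) g)" .
    qed
    then show "\<exists>e. computes (Suc (\<Sum>i<N. r i)) M \<rho> \<sigma> e (\<lambda>E v g. \<phi> E (\<lambda>i. v (r i)) g)" by blast
  qed
qed

lemma computable_apply [comp_intros]:
  assumes k: "k < M" and t: "computable M t"
  shows "computable M (\<lambda>E v g. g k (t E v g))"
proof (rule computable_push[where F = "\<lambda>E v g u. g k u", OF _ t], rule computableI)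
  fix \<rho> \<sigma> :: "nat \<Rightarrow> nat"
  show "computes 1 M \<rho> \<sigma> (list_encode [6, 0, \<rho> 0, list_encode [6, 1, \<sigma> k, list_encode [7]]])
      (\<lambda>E v g. g k (v 0))"
  proof (intro computesI kleene.S6_0 kleene.S6_1)
    fix as and v :: "nat \<Rightarrow> nat" and fs and g :: "nat \<Rightarrow> type1" and a y G
    assume "fits 1 \<rho> as v" and g: "fits M \<sigma> fs g"
    note f = to_front_fits[OF this(1) zero_less_one]
    show "\<rho> 0 < length as" by (rule f(1))
    show "\<sigma> k < length fs" by (rule to_front_fits(1)[OF g k])
    show "kleene (list_encode [7]) (to_front (\<rho> 0) as) (to_front (\<sigma> k) fs) [suslin, a, y] [G] (g k (v 0))"
      unfolding f(2) to_front_fits(2)[OF g k] by (rule kleene.S7)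
  qed
qed

lemma computable_Suc [comp_intros]:
  assumes t: "computable M t"
  shows "computable M (\<lambda>E v g. Suc (t E v g))"
proof (rule computable_push[where F = "\<lambda>E v g u. Suc u", OF _ t], rule computableI)
  fix \<rho> \<sigma> :: "nat \<Rightarrow> nat"
  show "computes 1 M \<rho> \<sigma> (list_encode [6, 0, \<rho> 0, list_encode [1]]) (\<lambda>E v g. Suc (v 0))"
  proof (intro computesI kleene.S6_0)
    fix as and v :: "nat \<Rightarrow> nat" and fs :: "type1 list" and a y G
    assume "fits 1 \<rho> as v"
    note f = to_front_fits[OF this zero_less_one]
    show "\<rho> 0 < length as" by (rule f(1))
    show "kleene (list_encode [1]) (to_front (\<rho> 0) as) fs [suslin, a, y] [G] (Suc (v 0))"
      unfolding f(2) by (rule kleene.S1)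
  qed
qed

lemma computable_rec [comp_intros]:
  assumes z: "computable M z" and s: "computable M (\<lambda>E v g. s E (\<lambda>i. v (Suc (Suc i))) g (v 0) (v (Suc 0)))"
    and n: "computable M n"
  shows "computable M (\<lambda>E v g. rec_nat (z E v g) (s E v g) (n E v g))"
proof -
  obtain N1 where N1: "\<And>\<rho> \<sigma>. \<exists>e. computes N1 M \<rho> \<sigma> e z"
    using z unfolding computable_def by blast
  obtain N2 where N2: "\<And>\<rho> \<sigma>. \<exists>e. computes N2 M \<rho> \<sigma> e (\<lambda>E v g. s E (\<lambda>i. v (Suc (Suc i))) g (v 0) (v (Suc 0)))"
    using s unfolding computable_def by blast
  obtain N3 where N3: "\<And>\<rho> \<sigma>. \<exists>e. computes N3 M \<rho> \<sigma> e n"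
    using n unfolding computable_def by blast
  define N where "N = max N1 (max N2 N3)"
  show ?thesis
    unfolding computable_def
  proof (rule exI[of _ N], intro allI)
    fix \<rho> \<sigma> :: "nat \<Rightarrow> nat"
    obtain c where c: "computes N1 M \<rho> \<sigma> c z" using N1 by blast
    \<comment> \<open>S5 puts the counter and the previous value in front of the arguments, so
      positions are shifted twice.\<close>
    obtain d where d: "computes N2 M (case_nat 0 (\<lambda>i. Suc (case_nat 0 (\<lambda>i. Suc (\<rho> i)) i))) \<sigma> d
        (\<lambda>E v g. s E (\<lambda>i. v (Suc (Suc i))) g (v 0) (v (Suc 0)))"
      using N2 by blast
    obtain b where b: "computes N3 M \<rho> \<sigma> b n" using N3 by blast
    have "computes N M \<rho> \<sigma> (list_encode [4, list_encode [5, c, d], b])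
        (\<lambda>E v g. rec_nat (z E v g) (s E v g) (n E v g))"
    proof (intro computesI kleene.S4)
      fix as and v :: "nat \<Rightarrow> nat" and a y G and fs :: "type1 list" and g
      assume v: "fits N \<rho> as v" and g: "fits M \<sigma> fs g"
      show "kleene b as fs [suslin, a, y] [G] (n (a, y, G) v g)"
        by (rule computesD[OF b fits_mono[OF v] g]) (simp add: N_def)
      have "kleene (list_encode [5, c, d]) (k # as) fs [suslin, a, y] [G]
        (rec_nat (z (a, y, G) v g) (s (a, y, G) v g) k)" for k
      proof (induction k)
        case 0
        have "kleene c as fs [suslin, a, y] [G] (z (a, y, G) v g)"
          by (rule computesD[OF c fits_mono[OF v] g]) (simp add: N_def)
        from kleene.S5_zero[OF this] show ?case by simp
      next
        case (Suc k)
        let ?u = "rec_nat (z (a, y, G) v g) (s (a, y, G) v g) k"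
        have "fits N2 (case_nat 0 (\<lambda>i. Suc (case_nat 0 (\<lambda>i. Suc (\<rho> i)) i))) (k # ?u # as) (case_nat k (case_nat ?u v))"
          by (rule fits_mono[OF fits_Cons[OF fits_Cons[OF v]]]) (simp add: N_def)
        from computesD[OF d this g, of a y G]
        have "kleene d (k # ?u # as) fs [suslin, a, y] [G] (s (a, y, G) v g k ?u)" by simp
        from kleene.S5_Suc[OF Suc this] show ?case by simp
      qed
      then show "kleene (list_encode [5, c, d]) (n (a, y, G) v g # as) fs [suslin, a, y] [G]
        (rec_nat (z (a, y, G) v g) (s (a, y, G) v g) (n (a, y, G) v g))" .
    qed
    then show "\<exists>e. computes N M \<rho> \<sigma> e (\<lambda>E v g. rec_nat (z E v g) (s E v g) (n E v g))" by blast
  qed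
qed

text \<open>Here \<open>c\<close> turns an index of the function argument into an index of the
  application; it absorbs any rearrangement of type 2 arguments made for S8.\<close>

lemma computable_type2:
  assumes h: "computable M (\<lambda>E v g. h E (\<lambda>i. v (Suc i)) g (v 0))"
    and F: "\<And>a y G d as fs k. (\<And>n. kleene d (n # as) fs [suslin, a, y] [G] (k n)) \<Longrightarrow>
      kleene (c d) as fs [suslin, a, y] [G] (F (a, y, G) k)"
  shows "computable M (\<lambda>E v g. F E (h E v g))"
proof -
  obtain N where N: "\<And>\<rho> \<sigma>. \<exists>e. computes N M \<rho> \<sigma> e (\<lambda>E v g. h E (\<lambda>i. v (Suc i)) g (v 0))"
    using h unfolding computable_def by blast
  show ?thesis
    unfolding computable_def
  proof (rule exI[of _ N], intro allI)
    fix \<rho> \<sigma> :: "nat \<Rightarrow> nat"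
    obtain d where d: "computes N M (case_nat 0 (\<lambda>i. Suc (\<rho> i))) \<sigma> d (\<lambda>E v g. h E (\<lambda>i. v (Suc i)) g (v 0))"
      using N by blast
    have "computes N M \<rho> \<sigma> (c d) (\<lambda>E v g. F E (h E v g))"
    proof (rule computesI, rule F)
      fix as and v :: "nat \<Rightarrow> nat" and a y G and fs :: "type1 list" and g k
      assume v: "fits N \<rho> as v" and g: "fits M \<sigma> fs g"
      have "fits N (case_nat 0 (\<lambda>i. Suc (\<rho> i))) (k # as) (case_nat k v)"
        by (rule fits_mono[OF fits_Cons[OF v]]) simp
      from computesD[OF d this g, of a y G]
      show "kleene d (k # as) fs [suslin, a, y] [G] (h (a, y, G) v g k)" by simp
    qed
    then show "\<exists>e. computes N M \<rho> \<sigma> e (\<lambda>E v g. F E (h E v g))" by blast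
  qed
qed

lemma computable_suslin:
  assumes "computable M (\<lambda>E v g. h E (\<lambda>i. v (Suc i)) g (v 0))"
  shows "computable M (\<lambda>E v g. suslin (h E v g))"
  by (rule computable_type2[OF assms kleene.S8_2])

lemma computable_first [comp_intros]:
  assumes "computable M (\<lambda>E v g. h E (\<lambda>i. v (Suc i)) g (v 0))"
  shows "computable M (\<lambda>E v g. fst E (h E v g))"
proof (rule computable_type2[OF assms])
  fix a y :: type2 and G d as fs and k :: type1
  \<comment> \<open>S8 applies the first type 2 argument only. The one moved to the front is moved
    back inside the computation of \<open>k\<close>.\<close>
  have 1: "to_front 1 [suslin, a, y] = [a, suslin, y]" "to_front 1 [a, suslin, y] = [suslin, a, y]"
    by (simp_all add: to_front_def)
  assume "\<And>n. kleene d (n # as) fs [suslin, a, y] [G] (k n)"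
  then have "kleene (list_encode [6, 2, 1, d]) (n # as) fs [a, suslin, y] [G] (k n)" for n
    by (intro kleene.S6_2) (simp_all only: 1, simp)
  from kleene.S6_2[OF _ kleene.S8_2[OF this, folded 1(1)]]
  show "kleene (list_encode [6, 2, 1, list_encode [8, 2, list_encode [6, 2, 1, d]]]) as fs [suslin, a, y] [G]
      (fst (a, y, G) k)"
    by simp
qed

lemma computable_second [comp_intros]:
  assumes "computable M (\<lambda>E v g. h E (\<lambda>i. v (Suc i)) g (v 0))"
  shows "computable M (\<lambda>E v g. fst (snd E) (h E v g))"
proof (rule computable_type2[OF assms])
  fix a y :: type2 and G d as fs and k :: type1
  \<comment> \<open>Moving the last of three arguments to the front is a cyclic shift, so two more
    such moves restore the order.\<close>
  have 2: "to_front 2 [suslin, a, y] = [y, suslin, a]" "to_front 2 [y, suslin, a] = [a, y, suslin]"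
    "to_front 2 [a, y, suslin] = [suslin, a, y]"
    by (simp_all add: to_front_def numeral_2_eq_2)
  assume "\<And>n. kleene d (n # as) fs [suslin, a, y] [G] (k n)"
  then have "kleene (list_encode [6, 2, 2, d]) (n # as) fs [a, y, suslin] [G] (k n)" for n
    by (intro kleene.S6_2) (simp_all only: 2, simp)
  then have "kleene (list_encode [6, 2, 2, list_encode [6, 2, 2, d]]) (n # as) fs [y, suslin, a] [G] (k n)" for n
    by (intro kleene.S6_2[of 2 _ "list_encode [6, 2, 2, d]"]) (simp_all only: 2, simp)
  from kleene.S6_2[OF _ kleene.S8_2[OF this, folded 2(1)]]
  show "kleene (list_encode [6, 2, 2, list_encode [8, 2, list_encode [6, 2, 2, list_encode [6, 2, 2, d]]]])
      as fs [suslin, a, y] [G] (fst (snd (a, y, G)) k)"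
    by simp
qed

lemma computable_type3 [comp_intros]:
  assumes H: "computable (Suc M) (\<lambda>E v g. H E v (\<lambda>i. g (Suc i)) (g 0))"
  shows "computable M (\<lambda>E v g. snd (snd E) (H E v g))"
proof -
  obtain N where N: "\<And>\<rho> \<sigma>. \<exists>e. computes N (Suc M) \<rho> \<sigma> e (\<lambda>E v g. H E v (\<lambda>i. g (Suc i)) (g 0))"
    using H unfolding computable_def by blast
  show ?thesis
    unfolding computable_def
  proof (rule exI[of _ N], intro allI)
    fix \<rho> \<sigma> :: "nat \<Rightarrow> nat"
    obtain d where d: "computes N (Suc M) \<rho> (case_nat 0 (\<lambda>i. Suc (\<sigma> i))) d (\<lambda>E v g. H E v (\<lambda>i. g (Suc i)) (g 0))"
      using N by blast
    have "computes N M \<rho> \<sigma> (list_encode [8, 3, d]) (\<lambda>E v g. snd (snd E) (H E v g))"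
    proof (intro computesI)
      fix as and v :: "nat \<Rightarrow> nat" and a y G and fs :: "type1 list" and g
      assume v: "fits N \<rho> as v" and g: "fits M \<sigma> fs g"
      have "kleene d as (z # fs) [suslin, a, y] [G] (H (a, y, G) v g z)" for z
        using computesD[OF d v fits_Cons[OF g, of z], of a y G] by simp
      from kleene.S8_3[OF this]
      show "kleene (list_encode [8, 3, d]) as fs [suslin, a, y] [G] (snd (snd (a, y, G)) (H (a, y, G) v g))"
        by (simp only: snd_conv)
    qed
    then show "\<exists>e. computes N M \<rho> \<sigma> e (\<lambda>E v g. snd (snd E) (H E v g))" by blast
  qed
qed

lemma computable_lift:
  assumes "computable M t"
  shows "computable M (\<lambda>E v g. t E (\<lambda>i. v (Suc i)) g)"
  using assms by (rule computable_rename)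

text \<open>Arguments are bound one at a time; the last one ends up at position 0, whence the
  reversal of the variables.\<close>

lemma computable2:
  assumes f: "computable M (\<lambda>E v g. f (v 0) (v (Suc 0)))" and x: "computable M x" and y: "computable M y"
  shows "computable M (\<lambda>E v g. f (x E v g) (y E v g))"
proof -
  have "computable M (\<lambda>E v g. f (v (Suc 0)) (v 0))"
    using computable_rename[OF f, of "case_nat (Suc 0) (\<lambda>_. 0)"] by simp
  from computable_push[where F = "\<lambda>E v g u. f (v 0) u", OF this computable_lift[OF y]]
  have "computable M (\<lambda>E v g. f (v 0) (y E (\<lambda>i. v (Suc i)) g))" .
  from computable_push[where F = "\<lambda>E v g u. f u (y E v g)", OF this x]
  show ?thesis .
qed

lemma computable1:
  assumes f: "computable M (\<lambda>E v g. f (v 0))" and x: "computable M x"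
  shows "computable M (\<lambda>E v g. f (x E v g))"
  by (rule computable_push[where F = "\<lambda>E v g u. f u", OF f x])

lemma computable3:
  assumes f: "computable M (\<lambda>E v g. f (v 0) (v (Suc 0)) (v (Suc (Suc 0))))"
    and x: "computable M x" and y: "computable M y" and z: "computable M z"
  shows "computable M (\<lambda>E v g. f (x E v g) (y E v g) (z E v g))"
proof -
  have "computable M (\<lambda>E v g. f (v (Suc (Suc 0))) (v (Suc 0)) (v 0))"
    using computable_rename[OF f, of "\<lambda>i. 2 - i"] by (simp add: numeral_2_eq_2)
  from computable_push[where F = "\<lambda>E v g u. f (v (Suc 0)) (v 0) u", OF this
      computable_lift[OF computable_lift[OF z]]]
  have "computable M (\<lambda>E v g. f (v (Suc 0)) (v 0) (z E (\<lambda>i. v (Suc (Suc i))) g))" .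
  from computable_push[where F = "\<lambda>E v g u. f (v 0) u (z E (\<lambda>i. v (Suc i)) g)", OF this computable_lift[OF y]]
  have "computable M (\<lambda>E v g. f (v 0) (y E (\<lambda>i. v (Suc i)) g) (z E (\<lambda>i. v (Suc i)) g))" .
  from computable_push[where F = "\<lambda>E v g u. f u (y E v g) (z E v g)", OF this x]
  show ?thesis .
qed

lemma computable4:
  assumes f: "computable M (\<lambda>E v g. f E (v 0) (v (Suc 0)) (v (Suc (Suc 0))) (v (Suc (Suc (Suc 0)))))"
    and x: "computable M x" and y: "computable M y" and z: "computable M z" and w: "computable M w"
  shows "computable M (\<lambda>E v g. f E (x E v g) (y E v g) (z E v g) (w E v g))"
proof -
  have "computable M (\<lambda>E v g. f E (v (Suc (Suc (Suc 0)))) (v (Suc (Suc 0))) (v (Suc 0)) (v 0))"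
    using computable_rename[OF f, of "\<lambda>i. 3 - i"] by (simp add: numeral_3_eq_3)
  from computable_push[where F = "\<lambda>E v g u. f E (v (Suc (Suc 0))) (v (Suc 0)) (v 0) u", OF this
      computable_lift[OF computable_lift[OF computable_lift[OF w]]]]
  have "computable M (\<lambda>E v g. f E (v (Suc (Suc 0))) (v (Suc 0)) (v 0) (w E (\<lambda>i. v (Suc (Suc (Suc i)))) g))" .
  from computable_push[where F = "\<lambda>E v g u. f E (v (Suc 0)) (v 0) u (w E (\<lambda>i. v (Suc (Suc i))) g)", OF this
      computable_lift[OF computable_lift[OF z]]]
  have "computable M (\<lambda>E v g. f E (v (Suc 0)) (v 0) (z E (\<lambda>i. v (Suc (Suc i))) g) (w E (\<lambda>i. v (Suc (Suc i))) g))" .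
  from computable_push[where F = "\<lambda>E v g u. f E (v 0) u (z E (\<lambda>i. v (Suc i)) g) (w E (\<lambda>i. v (Suc i)) g)", OF this
      computable_lift[OF y]]
  have "computable M (\<lambda>E v g. f E (v 0) (y E (\<lambda>i. v (Suc i)) g) (z E (\<lambda>i. v (Suc i)) g) (w E (\<lambda>i. v (Suc i)) g))" .
  from computable_push[where F = "\<lambda>E v g u. f E u (y E v g) (z E v g) (w E v g)", OF this x]
  show ?thesis .
qed

section \<open>Arithmetic and decidable relations\<close>

lemma computable_add [comp_intros]:
  assumes "computable M x" "computable M y"
  shows "computable M (\<lambda>E v g. x E v g + y E v g)"
proof -
  have "rec_nat m (\<lambda>_ u. Suc u) n = m + n" for m n by (induction n) auto
  then have "computable M (\<lambda>E v g. v 0 + v (Suc 0))"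
    using computable_rec[where s = "\<lambda>E v g a u. Suc u", OF computable_var computable_Suc[OF computable_var] computable_var]
    by simp
  from computable2[where f = "(+)", OF this assms] show ?thesis .
qed

lemma computable_mult [comp_intros]:
  assumes "computable M x" "computable M y"
  shows "computable M (\<lambda>E v g. x E v g * y E v g)"
proof -
  have "rec_nat 0 (\<lambda>_ u. u + m) n = m * n" for m n :: nat by (induction n) auto
  moreover have "computable M (\<lambda>E v g. rec_nat 0 (\<lambda>a u. u + v 0) (v (Suc 0)))"
    by (intro comp_intros)
  ultimately have "computable M (\<lambda>E v g. v 0 * v (Suc 0))" by simp
  from computable2[where f = "(*)", OF this assms] show ?thesis .
qed

lemma computable_diff [comp_intros]:
  assumes "computable M x" "computable M y"
  shows "computable M (\<lambda>E v g. x E v g - y E v g)"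
proof -
  have "rec_nat 0 (\<lambda>a _. a) n = n - 1" for n by (cases n) auto
  then have "rec_nat m (\<lambda>_ u. rec_nat 0 (\<lambda>a _. a) u) n = m - n" for m n by (induction n) auto
  moreover have "computable M (\<lambda>E v g. rec_nat (v 0) (\<lambda>_ u. rec_nat 0 (\<lambda>a _. a) u) (v (Suc 0)))"
    by (intro comp_intros)
  ultimately have "computable M (\<lambda>E v g. v 0 - v (Suc 0))" by simp
  from computable2[where f = "(-)", OF this assms] show ?thesis .
qed

lemma computable_power [comp_intros]:
  assumes "computable M x"
  shows "computable M (\<lambda>E v g. k ^ x E v g)"
proof -
  have "rec_nat 1 (\<lambda>_ u. u * k) n = k ^ n" for n by (induction n) auto
  moreover have "computable M (\<lambda>E v g. rec_nat 1 (\<lambda>_ u. u * k) (v 0))"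
    by (intro comp_intros)
  ultimately have "computable M (\<lambda>E v g. k ^ v 0)" by simp
  from computable1[where f = "(^) k", OF this assms] show ?thesis .
qed

lemma decidable_le [comp_intros]:
  assumes "computable M x" "computable M y"
  shows "decidable M (\<lambda>E v g. x E v g \<le> y E v g)"
proof -
  have "of_bool (m \<le> n) = 1 - (m - n)" for m n :: nat by auto
  then show ?thesis using assms by (simp only:) (intro comp_intros)
qed

lemma decidable_less [comp_intros]:
  assumes "computable M x" "computable M y"
  shows "decidable M (\<lambda>E v g. x E v g < y E v g)"
  unfolding less_eq_Suc_le using assms by (intro comp_intros)

lemma decidable_not [comp_intros]:
  assumes "decidable M P"
  shows "decidable M (\<lambda>E v g. \<not> P E v g)"
proof -
  have "of_bool (\<not> p) = (1 :: nat) - of_bool p" for p by simp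
  then show ?thesis using assms by (simp only:) (intro comp_intros)
qed

lemma decidable_and [comp_intros]:
  assumes "decidable M P" "decidable M Q"
  shows "decidable M (\<lambda>E v g. P E v g \<and> Q E v g)"
  unfolding of_bool_conj using assms by (intro comp_intros)

lemma decidable_or [comp_intros]:
  assumes "decidable M P" "decidable M Q"
  shows "decidable M (\<lambda>E v g. P E v g \<or> Q E v g)"
proof -
  have "P E v g \<or> Q E v g \<longleftrightarrow> \<not> (\<not> P E v g \<and> \<not> Q E v g)" for E v g by blast
  then show ?thesis using assms by (simp only:) (intro comp_intros)
qed

lemma decidable_imp [comp_intros]:
  assumes "decidable M P" "decidable M Q"
  shows "decidable M (\<lambda>E v g. P E v g \<longrightarrow> Q E v g)"
  unfolding imp_conv_disj using assms by (intro comp_intros)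

lemma decidable_eq [comp_intros]:
  assumes "computable M x" "computable M y"
  shows "decidable M (\<lambda>E v g. x E v g = y E v g)"
  unfolding eq_iff using assms by (intro comp_intros)

lemma computable_if [comp_intros]:
  assumes "decidable M P" "computable M x" "computable M y"
  shows "computable M (\<lambda>E v g. if P E v g then x E v g else y E v g)"
proof -
  have "(if P E v g then x E v g else y E v g) = of_bool (P E v g) * x E v g + (1 - of_bool (P E v g)) * y E v g"
    for E v g by simp
  then show ?thesis using assms by (simp only:) (intro comp_intros)
qed

section \<open>Number quantifiers from the Suslin functional\<close>

lemma le_course:
  assumes "i < n"
  shows "h i \<le> course h n"
proof -
  have "x \<le> list_encode xs" if "x \<in> set xs" for x xs
    using that by (induction xs) (auto intro: le_SucI le_prod_encode_1 order_trans[OF _ le_prod_encode_2])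
  then show ?thesis using assms by (auto simp: course_def)
qed

text \<open>The function vanishes at the empty sequence and at codes that bound a witness. Codes
  bound entries, so the constant path at a witness has only zeros; conversely the node of length one
  on a path has a nonzero code and yields a witness.\<close>

lemma suslin_exists:
  "suslin (\<lambda>s. if s = 0 then 0 else rec_nat 1 (\<lambda>a u. if P a then 0 else u) (Suc s)) = 1 - of_bool (\<exists>x. P x)"
proof -
  define r where "r = rec_nat (1::nat) (\<lambda>a u. if P a then 0 else u)"
  have r: "r n = 0 \<longleftrightarrow> (\<exists>x<n. P x)" for n
  proof (induction n)
    case (Suc n)
    have "r (Suc n) = (if P n then 0 else r n)" by (simp add: r_def)
    then show ?case using Suc by (cases "P n") (auto simp: less_Suc_eq)
  qed (simp add: r_def)
  define f where "f s = (if s = 0 then 0 else r (Suc s))" for s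
  have f: "f s = 0 \<longleftrightarrow> s = 0 \<or> (\<exists>x\<le>s. P x)" for s
    unfolding f_def using r[of "Suc s"] by (simp add: less_Suc_eq_le)
  have "(\<exists>h. \<forall>n. f (course h n) = 0) \<longleftrightarrow> (\<exists>x. P x)"
  proof
    assume "\<exists>h. \<forall>n. f (course h n) = 0"
    then obtain h where "f (course h 1) = 0" by blast
    moreover have "course h 1 \<noteq> 0" by (simp add: course_def)
    ultimately show "\<exists>x. P x" unfolding f by blast
  next
    assume "\<exists>x. P x"
    then obtain x where x: "P x" by blast
    have "f (course (\<lambda>_. x) n) = 0" for n
    proof (cases "n = 0")
      case False
      then have "x \<le> course (\<lambda>_. x) n" using le_course[of 0 n "\<lambda>_. x"] by simp
      then show ?thesis using x unfolding f by blast
    qed (simp add: course_def f)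
    then show "\<exists>h. \<forall>n. f (course h n) = 0" by blast
  qed
  then have "suslin f = 1 - of_bool (\<exists>x. P x)" unfolding suslin_def by simp
  then show ?thesis unfolding f_def[abs_def] r_def .
qed

lemma decidable_ex [comp_intros]:
  assumes "decidable M (\<lambda>E v g. P E (\<lambda>i. v (Suc i)) g (v 0))"
  shows "decidable M (\<lambda>E v g. \<exists>x. P E v g x)"
proof -
  have "of_bool (\<exists>x. P E v g x) =
    1 - suslin (\<lambda>s. if s = 0 then 0 else rec_nat 1 (\<lambda>a u. if P E v g a then 0 else u) (Suc s))" for E v g
    unfolding suslin_exists by simp
  \<comment> \<open>Three new variables precede the old ones: the two of the recursion and the
    sequence number.\<close>
  moreover have "decidable M (\<lambda>E v g. P E (\<lambda>i. v (Suc (Suc (Suc i)))) g (v 0))"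
    using computable_rename[OF assms, of "case_nat 0 (\<lambda>i. Suc (Suc (Suc i)))"] by simp
  ultimately show ?thesis by (simp only:) (intro comp_intros computable_suslin)
qed

lemma decidable_all [comp_intros]:
  assumes "decidable M (\<lambda>E v g. P E (\<lambda>i. v (Suc i)) g (v 0))"
  shows "decidable M (\<lambda>E v g. \<forall>x. P E v g x)"
proof -
  have "(\<forall>x. P E v g x) \<longleftrightarrow> \<not> (\<exists>x. \<not> P E v g x)" for E v g by blast
  then show ?thesis using assms by (simp only:) (intro comp_intros)
qed

lemma decidable_let [comp_intros]:
  assumes "computable M x" "decidable M (\<lambda>E v g. P E (\<lambda>i. v (Suc i)) g (v 0))"
  shows "decidable M (\<lambda>E v g. let u = x E v g in P E v g u)"
  unfolding Let_def
  by (rule computable_push[where F = "\<lambda>E v g u. of_bool (P E v g u)", OF assms(2,1)])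

section \<open>Bounded search and decoding of pairs and rationals\<close>

definition pick :: "nat \<Rightarrow> (nat \<Rightarrow> bool) \<Rightarrow> nat" where
  "pick n P = rec_nat 0 (\<lambda>a u. if P a then a else u) n"

text \<open>The search keeps the last hit below the bound, which is the witness when there is only
  one.\<close>

lemma pick_eq:
  assumes "\<And>b. P b \<longleftrightarrow> b = a" "a < n"
  shows "pick n P = a"
  using assms(2) unfolding pick_def assms(1) by (induction n) (auto simp: less_Suc_eq)

lemma computable_pick:
  assumes "computable M n" "decidable M (\<lambda>E v g. P E (\<lambda>i. v (Suc i)) g (v 0))"
  shows "computable M (\<lambda>E v g. pick (n E v g) (P E v g))"
proof -
  have "decidable M (\<lambda>E v g. P E (\<lambda>i. v (Suc (Suc i))) g (v 0))"
    using computable_rename[OF assms(2), of "case_nat 0 (\<lambda>i. Suc (Suc i))"] by simp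
  then show ?thesis unfolding pick_def using assms(1) by (intro comp_intros)
qed

lemma computable_prod_encode [comp_intros]:
  assumes "computable M x" "computable M y"
  shows "computable M (\<lambda>E v g. prod_encode (x E v g, y E v g))"
proof -
  have "triangle n = rec_nat 0 (\<lambda>a u. u + Suc a) n" for n by (induction n) auto
  then have "computable M (\<lambda>E v g. prod_encode (v 0, v (Suc 0)))"
    unfolding prod_encode_def prod.case by (simp only:) (intro comp_intros)
  from computable2[where f = "\<lambda>a b. prod_encode (a, b)", OF this assms] show ?thesis .
qed

lemma computable_fst_decode [comp_intros]:
  assumes "computable M x"
  shows "computable M (\<lambda>E v g. fst (prod_decode (x E v g)))"
proof -
  \<comment> \<open>A component is bounded by the code of the pair, so it can be searched for; the
    other component is left to a number quantifier.\<close>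
  have "fst (prod_decode c) = pick (Suc c) (\<lambda>u. \<exists>w. prod_encode (u, w) = c)" for c
    using le_prod_encode_1[of "fst (prod_decode c)" "snd (prod_decode c)"]
    by (intro pick_eq[symmetric]) (metis prod_encode_inverse prod_decode_inverse fst_conv prod.collapse, simp)
  then have "computable M (\<lambda>E v g. fst (prod_decode (v 0)))"
    by (simp only:) (intro comp_intros computable_pick)
  from computable1[where f = "\<lambda>c. fst (prod_decode c)", OF this assms] show ?thesis .
qed

lemma computable_snd_decode [comp_intros]:
  assumes "computable M x"
  shows "computable M (\<lambda>E v g. snd (prod_decode (x E v g)))"
proof -
  have "snd (prod_decode c) = pick (Suc c) (\<lambda>w. \<exists>u. prod_encode (u, w) = c)" for c
    using le_prod_encode_2[of "snd (prod_decode c)" "fst (prod_decode c)"]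
    by (intro pick_eq[symmetric]) (metis prod_encode_inverse prod_decode_inverse snd_conv prod.collapse, simp)
  then have "computable M (\<lambda>E v g. snd (prod_decode (v 0)))"
    by (simp only:) (intro comp_intros computable_pick)
  from computable1[where f = "\<lambda>c. snd (prod_decode c)", OF this assms] show ?thesis .
qed

lemma computable_half [comp_intros]:
  assumes "computable M x"
  shows "computable M (\<lambda>E v g. x E v g div 2)"
proof -
  have "c div 2 = pick (Suc c) (\<lambda>h. h + h = c \<or> Suc (h + h) = c)" for c
    by (intro pick_eq[symmetric]) presburger+
  then have "computable M (\<lambda>E v g. v 0 div 2)"
    by (simp only:) (intro comp_intros computable_pick)
  from computable1[where f = "\<lambda>c. c div 2", OF this assms] show ?thesis .
qed

lemma decidable_even [comp_intros]:
  assumes "computable M x"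
  shows "decidable M (\<lambda>E v g. even (x E v g))"
proof -
  have "even c \<longleftrightarrow> c div 2 + c div 2 = c" for c :: nat by presburger
  then show ?thesis using assms by (simp only:) (intro comp_intros)
qed

lemma computable_rat [comp_intros]:
  assumes "computable M x"
  shows "computable M (\<lambda>E v g. rat_pos (x E v g))" "computable M (\<lambda>E v g. rat_neg (x E v g))"
    "computable M (\<lambda>E v g. rat_den (x E v g))"
  unfolding rat_pos_def rat_neg_def rat_den_def int_pos_def int_neg_def
  by (intro comp_intros assms)+

lemma computable_rat_code [comp_intros]:
  assumes "computable M x" "computable M y"
  shows "computable M (\<lambda>E v g. rat_code (x E v g) (y E v g))"
  unfolding rat_code_def using assms by (intro comp_intros)

lemma decidable_rat_near [comp_intros]:
  assumes "computable M x" "computable M y" "computable M z"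
  shows "decidable M (\<lambda>E v g. rat_near (x E v g) (y E v g) (z E v g))"
proof -
  have "decidable M (\<lambda>E v g. rat_near (v 0) (v (Suc 0)) (v (Suc (Suc 0))))"
    unfolding rat_near_def by (intro comp_intros)
  from computable3[where f = "\<lambda>a b c. of_bool (rat_near a b c)", OF this assms] show ?thesis .
qed

lemma decidable_rat_between [comp_intros]:
  assumes "computable M x" "computable M y" "computable M z" "computable M w"
  shows "decidable M (\<lambda>E v g. rat_between (x E v g) (y E v g) (z E v g) (w E v g))"
  unfolding rat_between_def using assms by (intro comp_intros)

lemma decidable_rat_above_half [comp_intros]:
  assumes "computable M x"
  shows "decidable M (\<lambda>E v g. rat_above_half (x E v g))"
  unfolding rat_above_half_def using assms by (intro comp_intros)


section \<open>Sequence numbers and paths through trees\<close>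

definition code_drop :: "nat \<Rightarrow> nat \<Rightarrow> nat" where
  "code_drop s k = rec_nat s (\<lambda>_ u. snd (prod_decode (u - 1))) k"

definition code_nth :: "nat \<Rightarrow> nat \<Rightarrow> nat" where
  "code_nth s k = fst (prod_decode (code_drop s k - 1))"

text \<open>A nonempty list is coded by the successor of a pair of head and coded tail. The code 0
  of the empty list is a fixed point because 0 also codes the pair of zeros, so reaching 0 signals
  the end of the list.\<close>

lemma code_drop_list_encode: "code_drop (list_encode xs) k = list_encode (drop k xs)"
proof (induction k)
  case (Suc k)
  have "prod_decode 0 = (0, 0)"
    using prod_encode_inverse[of "(0, 0)"] by (simp add: prod_encode_def)
  then have tl: "snd (prod_decode (list_encode ys - 1)) = list_encode (tl ys)" for ys
    by (cases ys) simp_all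
  have "code_drop (list_encode xs) (Suc k) = snd (prod_decode (code_drop (list_encode xs) k - 1))"
    by (simp add: code_drop_def)
  then show ?case by (simp only: Suc tl) (simp add: tl_drop drop_Suc)
qed (simp add: code_drop_def)

lemma code_drop_course: "code_drop (course w n) k = 0 \<longleftrightarrow> n \<le> k"
  using list_encode_eq[of "drop k (map w [0..<n])" "[]"]
  by (auto simp: course_def code_drop_list_encode drop_map)

lemma code_nth_course:
  assumes "k < n"
  shows "code_nth (course w n) k = w k"
proof -
  have "drop k (map w [0..<n]) = w k # drop (Suc k) (map w [0..<n])"
    using assms Cons_nth_drop_Suc[of k "map w [0..<n]"] by simp
  then show ?thesis by (simp only: code_nth_def course_def code_drop_list_encode) simp
qed

lemma computable_code_nth [comp_intros]:
  assumes "computable M x" "computable M y"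
  shows "computable M (\<lambda>E v g. code_drop (x E v g) (y E v g))"
    and "computable M (\<lambda>E v g. code_nth (x E v g) (y E v g))"
  unfolding code_nth_def code_drop_def by (intro comp_intros assms)+

text \<open>Condition \<open>k\<close> depends on the first \<open>2 k + 2\<close> values of \<open>w\<close> and is checked on courses of greater length.\<close>

lemma suslin_tree:
  assumes "\<And>w w' k. (\<And>i. i \<le> Suc (k + k) \<Longrightarrow> w i = w' i) \<Longrightarrow> R w k \<longleftrightarrow> R w' k"
  shows "1 - suslin (\<lambda>s. of_bool (\<not> (\<forall>k. code_drop s (Suc (k + k)) \<noteq> 0 \<longrightarrow> R (code_nth s) k))) =
    of_bool (\<exists>w. \<forall>k. R w k)"
proof -
  have R: "R (code_nth (course w n)) k \<longleftrightarrow> R w k" if "Suc (k + k) < n" for w n k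
    using that by (intro assms code_nth_course) simp
  have "(\<exists>w. \<forall>n k. Suc (k + k) < n \<longrightarrow> R (code_nth (course w n)) k) \<longleftrightarrow> (\<exists>w. \<forall>k. R w k)"
  proof (intro iffI; elim exE)
    fix w assume *: "\<forall>n k. Suc (k + k) < n \<longrightarrow> R (code_nth (course w n)) k"
    have "R w k" for k
      using * R[OF lessI, of w k] by blast
    then show "\<exists>w. \<forall>k. R w k" by blast
  next
    fix w assume "\<forall>k. R w k"
    then show "\<exists>w. \<forall>n k. Suc (k + k) < n \<longrightarrow> R (code_nth (course w n)) k"
      using R by blast
  qed
  then show ?thesis unfolding suslin_def by (simp add: code_drop_course flip: not_less)
qed

text \<open>A path enters only through the codes of its courses, so the condition is decided with
  \<open>code_nth\<close> of a sequence number in place of the path.\<close>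

lemma decidable_tree:
  assumes "\<And>E v g w w' k. (\<And>i. i \<le> Suc (k + k) \<Longrightarrow> w i = w' i) \<Longrightarrow> R E v g w k \<longleftrightarrow> R E v g w' k"
    and R: "decidable M (\<lambda>E v g. R E (\<lambda>i. v (Suc (Suc i))) g (code_nth (v (Suc 0))) (v 0))"
  shows "decidable M (\<lambda>E v g. \<exists>w. \<forall>k. R E v g w k)"
proof -
  have "of_bool (\<exists>w. \<forall>k. R E v g w k) =
    1 - suslin (\<lambda>s. of_bool (\<not> (\<forall>k. code_drop s (Suc (k + k)) \<noteq> 0 \<longrightarrow> R E v g (code_nth s) k)))" for E v g
    by (rule suslin_tree[symmetric], rule assms(1))
  then show ?thesis
    by (simp only:) (intro comp_intros computable_suslin R)
qed

section \<open>Computing Cantor realisers\<close>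

text \<open>Away from codes \<open>a\<close> and \<open>y\<close> are unconstrained, so being a code
  has to be part of the test.\<close>

definition represents :: "type2 \<Rightarrow> type2 \<Rightarrow> nat \<Rightarrow> type1 \<Rightarrow> bool" where
  "represents a y n X \<longleftrightarrow> is_code X \<and> a X \<noteq> 0 \<and> y X = n"

lemma represents_iff:
  assumes "codes_set a A" "codes_nat_fun y Y"
  shows "represents a y n X \<longleftrightarrow> (\<exists>x\<in>{x \<in> A. Y x = n}. codes X x)"
proof (cases "is_code X")
  case True
  then obtain x where x: "codes X x" by (auto simp: is_code_iff)
  then have "a X = indicator A x" "y X = Y x"
    using assms by (auto simp: codes_set_def codes_nat_fun_def)
  moreover have "codes X z \<longleftrightarrow> z = x" for z using x codes_unique by blast
  ultimately show ?thesis using True by (auto simp: represents_def indicator_def)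
next
  case False
  then show ?thesis by (auto simp: represents_def is_code_iff)
qed

text \<open>In the codings \<open>sup_type3\<close> and \<open>approx_type3\<close> tags 0 and 1
  stand for the function and its sequence, both given here by one indicator. Two or three leading
  entries are skipped to reach the coded real; the other tags are left to \<open>h\<close>.\<close>

definition ind_arg :: "type2 \<Rightarrow> type2 \<Rightarrow> nat \<Rightarrow> type2 \<Rightarrow> type2" where
  "ind_arg a y n h z =
    (if z 0 = 0 then (if represents a y n (\<lambda>i. z (Suc (Suc i))) then rat_code 1 1 else rat_code 0 1)
     else if z 0 = 1 then (if represents a y n (\<lambda>i. z (Suc (Suc (Suc i)))) then rat_code 1 1 else rat_code 0 1)
     else h z)"

lemma computable_ind_arg [comp_intros]:
  assumes "k < M" "computable M n" "computable M (\<lambda>E v g. h E v g (g k))"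
  shows "computable M (\<lambda>E v g. ind_arg (fst E) (fst (snd E)) (n E v g) (h E v g) (g k))"
  unfolding ind_arg_def represents_def is_code_def
  by (intro comp_intros assms)

lemma represents_ind_rep:
  assumes "codes_set a A" "codes_nat_fun y Y"
  shows "(\<lambda>X l. if represents a y n X then rat_code 1 1 else rat_code 0 1) = ind_rep {x \<in> A. Y x = n}"
  by (simp only: ind_rep_def[abs_def] represents_iff[OF assms])

definition sup_prog :: "env \<Rightarrow> nat \<Rightarrow> nat \<Rightarrow> nat \<Rightarrow> nat \<Rightarrow> bool" where
  "sup_prog E n m m' d \<longleftrightarrow> rat_above_half (snd (snd E) (\<lambda>z. ind_arg (fst E) (fst (snd E)) n
     (\<lambda>z. if z 0 = 2 then rat_code m d else if z 0 = 3 then rat_code m' d else 2) z))"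

lemma sup_prog_eq:
  assumes "codes_set a A" "codes_nat_fun y Y"
  shows "sup_prog (a, y, sup_type3 \<Phi>) = (\<lambda>n. sup_test \<Phi> {x \<in> A. Y x = n})"
  by (simp add: fun_eq_iff sup_prog_def sup_test_def sup_type3_def ind_arg_def represents_ind_rep[OF assms, simplified])

lemma decidable_sup_prog:
  "decidable 0 (\<lambda>E v g. sup_prog E (v 0) (v (Suc 0)) (v (Suc (Suc 0))) (v (Suc (Suc (Suc 0)))))"
  unfolding sup_prog_def by (intro comp_intros) simp_all

definition approx_prog :: "env \<Rightarrow> nat \<Rightarrow> nat \<Rightarrow> nat \<Rightarrow> nat \<Rightarrow> bool" where
  "approx_prog E l m m' d \<longleftrightarrow> (\<exists>N w. \<forall>k. approx_node (\<lambda>n j c.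
     snd (snd E) (\<lambda>z. ind_arg (fst E) (fst (snd E)) l
       (\<lambda>z. if z 0 = 2 then n else if z 0 = 3 then j else if z 0 = 4 then c else 3) z)) N m m' d w k)"

lemma approx_prog_eq:
  assumes "codes_set a A" "codes_nat_fun y Y"
  shows "approx_prog (a, y, approx_type3 \<Psi>) = (\<lambda>l. approx_test \<Psi> {x \<in> A. Y x = l})"
  by (simp add: fun_eq_iff approx_prog_def approx_test_def approx_type3_def ind_arg_def represents_ind_rep[OF assms, simplified])

lemma decidable_approx_prog:
  "decidable 0 (\<lambda>E v g. approx_prog E (v 0) (v (Suc 0)) (v (Suc (Suc 0))) (v (Suc (Suc (Suc 0)))))"
proof -
  have local: "approx_node V N m m' d w k \<longleftrightarrow> approx_node V N m m' d w' k"
    if "\<And>i. i \<le> Suc (k + k) \<Longrightarrow> w i = w' i" for V N m m' d w w' k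
    using that unfolding approx_node_def by (intro conj_cong all_cong1 imp_cong refl) auto
  show ?thesis
    unfolding approx_prog_def
    \<comment> \<open>Locality lets \<open>decidable_tree\<close> treat the quantifier over
      \<open>w\<close>; the one over \<open>N\<close> is a number quantifier.\<close>
    by (intro comp_intros decidable_tree local, blast, unfold approx_node_def, intro comp_intros) simp_all
qed

lemma escape_eq_rec:
  "escape t n = rec_nat 0 (\<lambda>n u. if t n (5 * u) (5 * u + 3) (5 ^ Suc n) then 5 * u + 4 else 5 * u + 1) n"
  by (induction n) simp_all

lemma cantor_from_tests:
  assumes t: "decidable 0 (\<lambda>E v g. t E (v 0) (v (Suc 0)) (v (Suc (Suc 0))) (v (Suc (Suc (Suc 0)))))"
    and T: "\<And>A Y a y. codes_set a A \<Longrightarrow> codes_nat_fun y Y \<Longrightarrow> t (a, y, G) = (\<lambda>n. T {x \<in> A. Y x = n})"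
    and valid: "\<And>B. (\<And>x y. x \<in> B \<Longrightarrow> y \<in> B \<Longrightarrow> x = y) \<Longrightarrow> valid_test (T B) B"
  shows "\<exists>C. cantor_realiser C \<and> cantor_computable_in C G suslin"
proof (intro exI conjI)
  let ?C = "\<lambda>A Y. escape_real (\<lambda>n. T {x \<in> A. Y x = n})"
  show "cantor_realiser ?C"
    unfolding cantor_realiser_def
  proof (intro allI impI)
    fix A and Y :: "real \<Rightarrow> nat" assume "A \<subseteq> {0..1} \<and> A \<noteq> {} \<and> inj_on Y A"
    then have inj: "x = y" if "x \<in> {x \<in> A. Y x = n}" "y \<in> {x \<in> A. Y x = n}" for x y n
      using that by (auto dest: inj_onD)
    \<comment> \<open>The set \<open>A\<close> is the union of these sets, each with at most one
      element by injectivity.\<close>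
    have "?C A Y \<notin> {x \<in> A. Y x = n}" for n
      by (rule escape_real_notin[where n = n], rule valid) (use inj in blast)+
    then show "?C A Y \<in> {0..1} - A" using escape_real_unit by blast
  qed
  have dec: "decidable 0 (\<lambda>E v g. t E (x E v g) (y E v g) (z E v g) (w E v g))"
    if "computable 0 x" "computable 0 y" "computable 0 z" "computable 0 w" for x y z w
    by (rule computable4[where f = "\<lambda>E a b c d. of_bool (t E a b c d)", OF t that])
  have "computable 0 (\<lambda>E v g. escape_code (t E) (v 0))"
    unfolding escape_code_def escape_eq_rec by (intro comp_intros dec)
  then obtain N e where e: "computes N 0 (\<lambda>_. 0) (\<lambda>_. 0) e (\<lambda>E v g. escape_code (t E) (v 0))"
    unfolding computable_def by blast
  have k: "kleene e [l] [] [suslin, a, y] [G] (escape_code (t (a, y, G)) l)" for a y l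
  proof -
    \<comment> \<open>All \<open>N\<close> variables are read from the single argument
      \<open>l\<close>; the program only refers to the first.\<close>
    have "fits N (\<lambda>_. 0) [l] (\<lambda>_. l)" "fits 0 (\<lambda>_. 0) [] (\<lambda>_. zeros)" by (simp_all add: fits_def)
    from computesD[OF e this, of a y G] show ?thesis .
  qed
  show "cantor_computable_in ?C G suslin"
    unfolding cantor_computable_in_def
  proof (rule exI[of _ e], intro allI impI)
    fix A a y and Y :: "real \<Rightarrow> nat"
    assume "codes_set a A \<and> codes_nat_fun y Y"
    then have "t (a, y, G) = (\<lambda>n. T {x \<in> A. Y x = n})" using T by blast
    \<comment> \<open>The escaping real has a code whatever the test answers, so the program is
      total on all coded inputs.\<close>
    then show "\<exists>X. codes X (?C A Y) \<and> (\<forall>l. kleene e [l] [] [suslin, a, y] [G] (X l))"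
      using codes_escape[of "t (a, y, G)"] k[of _ a y]
      by (intro exI[of _ "escape_code (t (a, y, G))"]) simp
  qed
qed

theorem theorem4:
  shows "(\<forall>k. (\<forall>\<Phi>. is_sup_functional \<Phi> \<longrightarrow> \<not> sup_computable_in \<Phi> (S_functional k)) \<and>
              (\<forall>\<Psi>. is_approx_functional \<Psi> \<longrightarrow> \<not> approx_computable_in \<Psi> (S_functional k))) \<and>
         (\<forall>\<Phi>. is_sup_functional \<Phi> \<longrightarrow>
            (\<exists>C. cantor_realiser C \<and> cantor_computable_in C (sup_type3 \<Phi>) suslin)) \<and>
         (\<forall>\<Psi>. is_approx_functional \<Psi> \<longrightarrow>
            (\<exists>C. cantor_realiser C \<and> cantor_computable_in C (approx_type3 \<Psi>) suslin))"
proof (intro conjI allI impI)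
  fix \<Phi> assume \<Phi>: "is_sup_functional \<Phi>"
  show "\<exists>C. cantor_realiser C \<and> cantor_computable_in C (sup_type3 \<Phi>) suslin"
    by (rule cantor_from_tests[OF decidable_sup_prog sup_prog_eq valid_sup_test[OF \<Phi>]])
next
  fix \<Psi> assume \<Psi>: "is_approx_functional \<Psi>"
  show "\<exists>C. cantor_realiser C \<and> cantor_computable_in C (approx_type3 \<Psi>) suslin"
    by (rule cantor_from_tests[OF decidable_approx_prog approx_prog_eq valid_approx_test[OF \<Psi>]])
qed (simp_all add: sup_not_computable approx_not_computable)

end
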